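(* For every weight $w$ on $\mathbb{R}^n$, $$[w]^{weak}_{A_\infty}\ \approx\ \sup_{f:\ \|f\|_{\mathrm{BMO}}=1}\ \sup_{Q}\ \frac{1}{w(2Q)}\int_Q|f(x)-f_Q|\,w(x)\,dx,$$ that is, each side is bounded by a constant depending only on $n$ times the other.
   Context: A weight is a non-negative locally integrable function on $\mathbb{R}^n$; $w(E)=\int_E w\,dx$. Cubes have sides parallel to the axes, and $2Q$ is the cube concentric with $Q$ with twice its side length. For $f\in L^1_{loc}(\mathbb{R}^n)$, $f_Q=\frac{1}{|Q|}\int_Q f$ and $\|f\|_{\mathrm{BMO}}=\sup_Q\frac{1}{|Q|}\int_Q|f-f_Q|\,dx$. Define $$[w]^{weak}_{A_\infty}=\sup_Q\frac{1}{w(2Q)}\int_Q M(w\chi_Q)\,dx,$$ where $M$ is the Hardy–Littlewood maximal operator $Mg(x)=\sup_{R\ni x}\frac{1}{|R|}\int_R|g|$ (supremum over cubes $R$ containing $x$). Suprema of quotients with denominator $w(2Q)$ are taken over cubes $Q$ with $w(2Q)>0$. The quantities may equal $+\infty$. *)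

theory Defs
  imports "HOL-Analysis.Analysis"
begin

definition cube :: "real^'n \<Rightarrow> real \<Rightarrow> (real^'n) set" where
  "cube c l = cbox (c - (\<chi> i. l / 2)) (c + (\<chi> i. l / 2))"

(* Cubes are closed and nondegenerate. A cube determines its centre c and side length l > 0,
   so suprema over cubes Q are written over pairs (c, l), and 2Q is cube c (2 * l). *)

definition locally_integrable :: "(real^'n \<Rightarrow> real) \<Rightarrow> bool" where
  "locally_integrable f \<longleftrightarrow> (\<forall>K. compact K \<longrightarrow> f absolutely_integrable_on K)"

definition weight :: "(real^'n \<Rightarrow> real) \<Rightarrow> bool" where
  "weight w \<longleftrightarrow> locally_integrable w \<and> (\<forall>x. 0 \<le> w x)"

definition wmeas :: "(real^'n \<Rightarrow> real) \<Rightarrow> (real^'n) set \<Rightarrow> ennreal" where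
  "wmeas w E = (\<integral>\<^sup>+x\<in>E. ennreal (w x) \<partial>lebesgue)"

definition avg :: "(real^'n \<Rightarrow> real) \<Rightarrow> (real^'n) set \<Rightarrow> real" where
  "avg f Q = (LINT x:Q|lebesgue. f x) / measure lebesgue Q"

definition bmo_norm :: "(real^'n \<Rightarrow> real) \<Rightarrow> ennreal" where
  "bmo_norm f = (SUP (c, l)\<in>{(c, l). 0 < l}.
     (\<integral>\<^sup>+x\<in>cube c l. ennreal \<bar>f x - avg f (cube c l)\<bar> \<partial>lebesgue)
       / emeasure lebesgue (cube c l))"

definition maximal_op :: "(real^'n \<Rightarrow> real) \<Rightarrow> real^'n \<Rightarrow> ennreal" where
  "maximal_op g x = (SUP (c, l)\<in>{(c, l). 0 < l \<and> x \<in> cube c l}.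
     (\<integral>\<^sup>+y\<in>cube c l. ennreal \<bar>g y\<bar> \<partial>lebesgue) / emeasure lebesgue (cube c l))"

(* The supremum of the empty set in ennreal is 0; this is the value of both suprema below
   when w vanishes almost everywhere. *)

definition weak_Ainf :: "(real^'n \<Rightarrow> real) \<Rightarrow> ennreal" where
  "weak_Ainf w = (SUP (c, l)\<in>{(c, l). 0 < l \<and> 0 < wmeas w (cube c (2 * l))}.
     (\<integral>\<^sup>+x\<in>cube c l. maximal_op (\<lambda>y. w y * indicator (cube c l) y) x \<partial>lebesgue)
       / wmeas w (cube c (2 * l)))"

definition weighted_oscillation :: "(real^'n \<Rightarrow> real) \<Rightarrow> (real^'n \<Rightarrow> real) \<Rightarrow> ennreal" where
  "weighted_oscillation w f = (SUP (c, l)\<in>{(c, l). 0 < l \<and> 0 < wmeas w (cube c (2 * l))}.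
     (\<integral>\<^sup>+x\<in>cube c l. ennreal (\<bar>f x - avg f (cube c l)\<bar> * w x) \<partial>lebesgue)
       / wmeas w (cube c (2 * l)))"

end

theory Submission
  imports Defs
begin

text \<open>Both inequalities are local.  For one cube \<open>Q\<close> they compare the integral of \<open>\<bar>f - f\<^sub>Q\<bar> w\<close> over \<open>Q\<close> with
the integral of \<open>M (w \<chi>\<^sub>Q)\<close> over \<open>Q\<close>, and both comparisons are made on the dyadic grid generated
by \<open>Q\<close>.  Write \<open>f\<^sub>P\<close> for the average of \<open>f\<close> over \<open>P\<close> and \<open>w(P)\<close> for the mass of \<open>P\<close>.

The oscillation is at most a multiple of the maximal function (\<open>oscillation_le_maximal\<close>).  Follow
the dyadic averages of \<open>f\<close> towards a point.  While they stay within distance \<open>2\<close> of a reference value,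
the cost is \<open>2 w\<close>; when they leave this range they overshoot by at most \<open>2^n\<close>, and the run is restarted
with the new average as reference value.  As the mean oscillation is at most \<open>1\<close>, the restart cells
inside a restart cell \<open>P\<close> fill at most half of \<open>P\<close>, so \<open>w(P) = w\<^sub>P \<bar>P\<bar>\<close> is at most twice the integral
of the dyadic maximal function over the rest of \<open>P\<close>.  The whole argument is one induction over
generations (\<open>avg_oscillation_recursion\<close>) for an inequality whose terms are additive over children, so
that no family of restart cells has to be constructed.  Lebesgue differentiation and Fatou's lemma pass
from the averages to \<open>f\<close>.

The maximal function is at most a multiple of the oscillation (\<open>maximal_le_oscillation\<close>).  Select a cell
whenever the average of \<open>w\<close> has more than doubled since the last selected cell.  On \<open>Q\<close> the maximal
function is dominated by the sum of \<open>w\<^sub>P \<chi>\<^bsub>3P\<^esub>\<close> over the selected \<open>P\<close> (\<open>maximal_op_le_stop_sum\<close>), so its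
integral is at most a multiple of the sum of the \<open>w(P)\<close>.  The selected cells inside any cell have total
volume at most three times that of the cell (\<open>packed_stops\<close>).  Hence, for finitely many of them, a sum \<open>f\<close>
of tents, one over each \<open>P\<close>, has BMO norm bounded in terms of \<open>n\<close> only (\<open>bmo_norm_tent_sum_le\<close>), while
\<open>f\<^sub>Q\<close> is bounded and \<open>f\<close> is at least the number of selected cells above a point.  Therefore the
sum of the \<open>w(P)\<close> is at most the integral of \<open>f w\<close>, which is at most that of \<open>\<bar>f - f\<^sub>Q\<bar> w\<close> plus a
multiple of \<open>w(Q)\<close>.

The term \<open>w(Q)\<close> is absorbed because the supremum of oscillations is bounded below for every weight that
is not null (\<open>osc_sup_lower_bound\<close>): the indicator of a dyadic child of \<open>Q\<close> oscillates everywhere on \<open>Q\<close>,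
so otherwise \<open>w(Q)\<close> would be a tiny fraction of \<open>w(2Q)\<close> for every \<open>Q\<close>, which forces \<open>w\<close> to vanish.\<close>

section \<open>Cubes and locally integrable functions\<close>

lemma infnorm_le_iff_cart:
  fixes x :: "real^'n"
  shows "infnorm x \<le> t \<longleftrightarrow> (\<forall>i. \<bar>x $ i\<bar> \<le> t)"
  unfolding infnorm_Max by (auto simp: Basis_vec_def inner_axis)

lemma mem_cube_iff_infnorm: "x \<in> cube c l \<longleftrightarrow> infnorm (x - c) \<le> l / 2"
proof -
  have "c $ i - l / 2 \<le> x $ i \<and> x $ i \<le> c $ i + l / 2 \<longleftrightarrow> \<bar>x $ i - c $ i\<bar> \<le> l / 2" for i
    by arith
  then show ?thesis
    unfolding cube_def infnorm_le_iff_cart mem_box_cart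
    by (simp only: vector_minus_component vector_add_component vec_lambda_beta)
qed

lemma compact_cube [simp]: "compact (cube c l)"
  by (simp add: cube_def)

lemma sets_lebesgue_cube [measurable, simp]: "cube c l \<in> sets lebesgue"
  by (simp add: cube_def)

lemma lmeasurable_cube [simp]: "cube c l \<in> lmeasurable"
  by (simp add: cube_def)

lemma measure_lebesgue_cube:
  fixes c :: "real^'n"
  assumes "0 \<le> l"
  shows "measure lebesgue (cube c l) = l ^ CARD('n)"
proof -
  have "cbox (c - (\<chi> i. l / 2)) (c + (\<chi> i. l / 2)) \<noteq> {}"
    using assms by (auto simp: interval_ne_empty_cart)
  then show ?thesis
    by (simp add: cube_def content_cbox_cart)
qed

lemma emeasure_lebesgue_cube:
  fixes c :: "real^'n"
  assumes "0 \<le> l"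
  shows "emeasure lebesgue (cube c l) = ennreal (l ^ CARD('n))"
  using measure_lebesgue_cube[OF assms, of c] emeasure_eq_measure2[OF lmeasurable_cube[of c l]]
  by simp

lemma cube_subset_cube:
  assumes "infnorm (c - c') + l / 2 \<le> l' / 2"
  shows "cube c l \<subseteq> cube c' l'"
proof
  fix x assume "x \<in> cube c l"
  moreover have "infnorm (x - c') \<le> infnorm (x - c) + infnorm (c - c')"
    using infnorm_triangle[of "x - c" "c - c'"] by simp
  ultimately show "x \<in> cube c' l'"
    using assms by (simp add: mem_cube_iff_infnorm)
qed

lemma corner_cube_eq_cube:
  fixes x :: "real^'n"
  shows "cbox x (x + s *\<^sub>R One) = cube (x + (\<chi> i. s / 2)) s"
proof -
  have "(One :: real^'n) $ i = 1" for i
    using inner_sum_Basis[of "axis i 1 :: real^'n"] by (simp add: cart_eq_inner_axis)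
  then have "x + s *\<^sub>R One = x + (\<chi> i. s / 2) + (\<chi> i. s / 2)"
    by (simp add: vec_eq_iff del: sum_component)
  then show ?thesis
    unfolding cube_def by (simp only: add_diff_cancel_right')
qed

lemma locally_integrable_set_integrable:
  assumes "locally_integrable f"
  shows "set_integrable lebesgue (cube c l) f"
  using assms compact_cube unfolding locally_integrable_def by blast

lemma exhausting_cubes:
  fixes x :: "real^'n"
  shows "\<exists>N. \<forall>n\<ge>N. x \<in> cube 0 (real n)"
proof -
  obtain N :: nat where "2 * infnorm x \<le> N"
    using real_arch_simple by blast
  then have "\<forall>n\<ge>N. x \<in> cube 0 (real n)"
    by (auto simp: mem_cube_iff_infnorm)
  then show ?thesis by blast
qed

lemma locally_integrable_borel_measurable:
  fixes f :: "real^'n \<Rightarrow> real"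
  assumes "locally_integrable f"
  shows "f \<in> borel_measurable lebesgue"
proof (rule borel_measurable_LIMSEQ_real)
  fix x :: "real^'n"
  obtain N where "\<forall>n\<ge>N. x \<in> cube 0 (real n)"
    using exhausting_cubes by blast
  then have "eventually (\<lambda>n. indicator (cube 0 (real n)) x *\<^sub>R f x = f x) sequentially"
    unfolding eventually_sequentially by (intro exI[of _ N]) auto
  then show "(\<lambda>n. indicator (cube 0 (real n)) x *\<^sub>R f x) \<longlonglongrightarrow> f x"
    by (rule tendsto_eventually)
next
  fix n :: nat
  show "(\<lambda>x. indicator (cube 0 (real n)) x *\<^sub>R f x) \<in> borel_measurable lebesgue"
    using locally_integrable_set_integrable[OF assms]
    unfolding set_integrable_def by (rule borel_measurable_integrable)
qed

lemma set_integrable_subset_cube: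
  assumes "locally_integrable f" "E \<in> sets lebesgue" "E \<subseteq> cube c l"
  shows "set_integrable lebesgue E f"
  using set_integrable_subset[OF locally_integrable_set_integrable[OF assms(1)] assms(2,3)] .

lemma continuous_imp_locally_integrable:
  fixes f :: "real^'n \<Rightarrow> real"
  assumes "continuous_on UNIV f"
  shows "locally_integrable f"
  unfolding locally_integrable_def
proof (intro allI impI)
  fix K :: "(real^'n) set" assume K: "compact K"
  then obtain u where u: "K \<subseteq> cbox (- u) u"
    using bounded_subset_cbox_symmetric compact_imp_bounded by metis
  have "f absolutely_integrable_on cbox (- u) u"
    by (rule absolutely_integrable_continuous) (rule continuous_on_subset[OF assms subset_UNIV])
  then show "f absolutely_integrable_on K"
    by (rule set_integrable_subset) (use K u in \<open>simp_all add: lmeasurable_compact fmeasurableD\<close>)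
qed

lemma weight_borel_measurable: "weight w \<Longrightarrow> w \<in> borel_measurable lebesgue"
  and weight_nonneg: "weight w \<Longrightarrow> 0 \<le> w x"
  by (auto simp: weight_def locally_integrable_borel_measurable)

lemma wmeas_mono:
  assumes "E \<subseteq> F"
  shows "wmeas w E \<le> wmeas w F"
  unfolding wmeas_def
  using assms by (intro nn_integral_mono) (auto simp: indicator_def)

lemma wmeas_cube_finite:
  assumes "weight w"
  shows "wmeas w (cube c l) < \<infinity>"
proof -
  have "integrable lebesgue (\<lambda>x. indicator (cube c l) x *\<^sub>R w x)"
    using locally_integrable_set_integrable[of w c l] assms
    unfolding set_integrable_def weight_def by blast
  then have "(\<integral>\<^sup>+ x. norm (indicator (cube c l) x *\<^sub>R w x) \<partial>lebesgue) < \<infinity>"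
    by (simp only: integrable_iff_bounded)
  also have "(\<integral>\<^sup>+ x. norm (indicator (cube c l) x *\<^sub>R w x) \<partial>lebesgue) = wmeas w (cube c l)"
    unfolding wmeas_def
    by (intro nn_integral_cong) (auto simp: indicator_def weight_nonneg[OF assms])
  finally show ?thesis .
qed

lemma wmeas_subset_cube_finite:
  "weight w \<Longrightarrow> E \<subseteq> cube c l \<Longrightarrow> wmeas w E < \<infinity>"
  using wmeas_cube_finite[of w c l] wmeas_mono[of E "cube c l" w] by (simp add: order_le_less_trans)

lemma mult_right_mono_indicator:
  fixes u v :: ennreal
  assumes "x \<in> A \<Longrightarrow> u \<le> v"
  shows "u * indicator A x \<le> v * indicator A x"
  using assms by (cases "x \<in> A") simp_all

lemma ennreal_divide_le_iff:
  fixes a b c :: ennreal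
  assumes "0 < c" "c < top"
  shows "a / c \<le> b \<longleftrightarrow> a \<le> b * c"
  using assms
  by (cases a; cases b; cases c)
     (auto simp: divide_ennreal ennreal_mult[symmetric] field_simps ennreal_top_mult ennreal_top_divide
       top_unique)

lemma nn_integral_finite_Union_disjoint:
  assumes "finite I" "disjoint_family_on A I" "\<And>i. i \<in> I \<Longrightarrow> A i \<in> sets M"
    and "h \<in> borel_measurable M"
  shows "(\<integral>\<^sup>+x\<in>(\<Union>i\<in>I. A i). h x \<partial>M) = (\<Sum>i\<in>I. \<integral>\<^sup>+x\<in>A i. h x \<partial>M)"
proof -
  have "(\<integral>\<^sup>+x\<in>(\<Union>i\<in>I. A i). h x \<partial>M) = (\<integral>\<^sup>+x. (\<Sum>i\<in>I. h x * indicator (A i) x) \<partial>M)"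
    by (intro nn_integral_cong)
       (simp only: indicator_UN_disjoint[OF assms(1,2)] sum_distrib_left)
  also have "\<dots> = (\<Sum>i\<in>I. \<integral>\<^sup>+x\<in>A i. h x \<partial>M)"
  proof (rule nn_integral_sum)
    fix i assume "i \<in> I"
    then have [measurable]: "A i \<in> sets M" and [measurable]: "h \<in> borel_measurable M"
      using assms by auto
    show "(\<lambda>x. h x * indicator (A i) x) \<in> borel_measurable M" by measurable
  qed
  finally show ?thesis .
qed

section \<open>Dyadic cells\<close>

text \<open>The cells of generation \<open>k\<close> have side \<open>L / 2^k\<close> and are indexed by integer vectors; \<open>a\<close> is the lower
corner of cell \<open>0\<close> of generation \<open>0\<close>, which is the cube of interest up to a null set.  Cells are half-open,
so that those of one generation partition the space and the cell of a point is given by floors (\<open>idx\<close>).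
Parents and ancestors then correspond to integer division of the index by powers of \<open>2\<close>.\<close>

locale dyadic_grid =
  fixes a :: "real^'n" and L :: real
  assumes L_pos: "0 < L"
begin

definition side :: "nat \<Rightarrow> real" where "side k = L / 2 ^ k"

definition cell :: "nat \<Rightarrow> int^'n \<Rightarrow> (real^'n) set" where
  "cell k m = {x. \<forall>i. a $ i + of_int (m $ i) * side k \<le> x $ i
                 \<and> x $ i < a $ i + (of_int (m $ i) + 1) * side k}"

definition idx :: "nat \<Rightarrow> real^'n \<Rightarrow> int^'n" where
  "idx k x = (\<chi> i. \<lfloor>(x $ i - a $ i) / side k\<rfloor>)"

definition centre :: "nat \<Rightarrow> int^'n \<Rightarrow> real^'n" where
  "centre k m = (\<chi> i. a $ i + (of_int (m $ i) + 1 / 2) * side k)"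

abbreviation closed_cell :: "nat \<Rightarrow> int^'n \<Rightarrow> (real^'n) set" where
  "closed_cell k m \<equiv> cube (centre k m) (side k)"

definition anc :: "nat \<Rightarrow> nat \<Rightarrow> int^'n \<Rightarrow> int^'n" where
  "anc j k m = (\<chi> i. m $ i div 2 ^ (j - k))"

definition children :: "int^'n \<Rightarrow> (int^'n) set" where
  "children m = {m'. \<forall>i. m' $ i div 2 = m $ i}"

lemma side_pos [simp]: "0 < side k"
  using L_pos by (simp add: side_def)

lemma side_nonneg [simp]: "0 \<le> side k"
  using side_pos[of k] by linarith

lemma side_neq_0 [simp]: "side k \<noteq> 0"
  using side_pos[of k] by linarith

lemma side_0 [simp]: "side 0 = L"
  by (simp add: side_def)

lemma side_Suc: "side (Suc k) = side k / 2"
  by (simp add: side_def)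

lemma side_antimono: "j \<le> k \<Longrightarrow> side k \<le> side j"
  using L_pos by (simp add: side_def frac_le power_increasing)

lemma side_tendsto_0: "side \<longlonglongrightarrow> 0"
proof -
  have "(\<lambda>k. L * (1 / 2) ^ k) \<longlonglongrightarrow> L * 0"
    by (intro tendsto_intros LIMSEQ_power_zero) auto
  moreover have "side = (\<lambda>k. L * (1 / 2) ^ k)"
    by (simp add: side_def fun_eq_iff power_one_over)
  ultimately show ?thesis by simp
qed

lemma side_eventually_less:
  assumes "0 < d"
  shows "\<forall>\<^sub>F k in sequentially. side k < d"
  using order_tendstoD(2)[OF side_tendsto_0 assms] .

lemma ex_side_le:
  assumes "0 < l" shows "\<exists>k. side k \<le> l"
  using eventually_happens[OF side_eventually_less[OF assms]] by (auto intro: less_imp_le)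

lemma mem_cell_iff_idx: "x \<in> cell k m \<longleftrightarrow> idx k x = m"
proof -
  have "\<lfloor>(x $ i - a $ i) / side k\<rfloor> = m $ i \<longleftrightarrow>
    a $ i + of_int (m $ i) * side k \<le> x $ i \<and> x $ i < a $ i + (of_int (m $ i) + 1) * side k" for i
    using side_pos[of k] by (simp add: floor_eq_iff pos_le_divide_eq pos_divide_less_eq) linarith
  then show ?thesis
    by (simp add: cell_def idx_def vec_eq_iff)
qed

lemma mem_cell_idx [simp]: "x \<in> cell k (idx k x)"
  by (simp add: mem_cell_iff_idx)

lemma disjoint_cells: "disjoint_family_on (cell k) I"
  by (auto simp: disjoint_family_on_def mem_cell_iff_idx)

lemma anc_refl [simp]: "anc k k m = m"
  by (simp add: anc_def vec_eq_iff)

lemma side_shift: "j \<le> k \<Longrightarrow> side j = side k * 2 ^ (k - j)"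
  using L_pos by (simp add: side_def power_diff)

lemma idx_eq_anc:
  assumes "k \<le> j"
  shows "idx k x = anc j k (idx j x)"
proof -
  have "\<lfloor>(x $ i - a $ i) / side k\<rfloor> = \<lfloor>(x $ i - a $ i) / side j\<rfloor> div 2 ^ (j - k)" for i
  proof -
    have "(x $ i - a $ i) / side k = (x $ i - a $ i) / side j / real_of_int (2 ^ (j - k))"
      by (simp add: side_shift[OF assms])
    then show ?thesis
      by (simp only: floor_divide_real_eq_div[of "2 ^ (j - k)"] zero_le_power zero_le_numeral)
  qed
  then show ?thesis
    by (simp add: idx_def anc_def)
qed

lemma cell_subset_anc: "k \<le> j \<Longrightarrow> cell j m \<subseteq> cell k (anc j k m)"
  by (auto simp: mem_cell_iff_idx idx_eq_anc)

lemma children_iff_anc: "m' \<in> children m \<longleftrightarrow> anc (Suc k) k m' = m"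
  by (simp add: children_def anc_def vec_eq_iff)

lemma anc_anc:
  assumes "i \<le> k" "k \<le> j"
  shows "anc k i (anc j k m) = anc j i m"
proof -
  have "x div 2 ^ (j - k) div 2 ^ (k - i) = x div (2 ^ (j - i)::int)" for x
    using assms by (simp add: zdiv_zmult2_eq[symmetric] power_add[symmetric])
  then show ?thesis by (simp add: anc_def)
qed

lemma cell_eq_Union_children: "cell k m = (\<Union>m'\<in>children m. cell (Suc k) m')"
  by (auto simp: mem_cell_iff_idx children_iff_anc[of _ _ k] idx_eq_anc[of k "Suc k"])

lemma finite_children [simp]: "finite (children m)"
proof -
  have "children m \<subseteq> {v. \<forall>i. v $ i \<in> {2 * m $ i .. 2 * m $ i + 1}}"
  proof
    fix v assume "v \<in> children m"
    then have *: "v $ i div 2 = m $ i" for i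
      by (simp add: children_def)
    have "2 * m $ i \<le> v $ i \<and> v $ i \<le> 2 * m $ i + 1" for i
      unfolding *[of i, symmetric] by presburger
    then show "v \<in> {v. \<forall>i. v $ i \<in> {2 * m $ i .. 2 * m $ i + 1}}"
      by simp
  qed
  moreover have "finite {v :: int^'n. \<forall>i. v $ i \<in> {2 * m $ i .. 2 * m $ i + 1}}"
  proof -
    have "{v :: int^'n. \<forall>i. v $ i \<in> {2 * m $ i .. 2 * m $ i + 1}}
      \<subseteq> vec_lambda ` (PiE UNIV (\<lambda>i. {2 * m $ i .. 2 * m $ i + 1}))"
    proof
      fix v :: "int^'n" assume "v \<in> {v. \<forall>i. v $ i \<in> {2 * m $ i .. 2 * m $ i + 1}}"
      then show "v \<in> vec_lambda ` (PiE UNIV (\<lambda>i. {2 * m $ i .. 2 * m $ i + 1}))"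
        by (intro image_eqI[of _ _ "vec_nth v"]) auto
    qed
    then show ?thesis
      by (rule finite_subset) (intro finite_imageI finite_PiE, auto)
  qed
  ultimately show ?thesis
    by (rule finite_subset)
qed

lemma cell_subset_closed_cell: "cell k m \<subseteq> closed_cell k m"
proof
  fix x assume x: "x \<in> cell k m"
  have "\<bar>x $ i - centre k m $ i\<bar> \<le> side k / 2" for i
  proof -
    have "a $ i + of_int (m $ i) * side k \<le> x $ i" "x $ i < a $ i + (of_int (m $ i) + 1) * side k"
      using x by (auto simp: cell_def)
    then show ?thesis
      by (intro abs_leI) (simp_all add: centre_def algebra_simps)
  qed
  then show "x \<in> closed_cell k m"
    unfolding mem_cube_iff_infnorm infnorm_le_iff_cart by simp
qed

lemma cell_nonempty: "cell k m \<noteq> {}"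
proof -
  have "(\<chi> i. a $ i + of_int (m $ i) * side k) \<in> cell k m"
    by (simp add: cell_def algebra_simps)
  then show ?thesis by blast
qed

lemma infnorm_le_of_mem_cell:
  assumes "x \<in> cell k m"
  shows "infnorm (x - centre k m) \<le> side k / 2"
  using assms by (rule subsetD[OF cell_subset_closed_cell, unfolded mem_cube_iff_infnorm])

lemma infnorm_diff_cell_le:
  assumes "x \<in> cell k m" "y \<in> cell k m"
  shows "infnorm (x - y) \<le> side k"
proof -
  have "infnorm (x - y) \<le> infnorm (x - centre k m) + infnorm (centre k m - y)"
    using infnorm_triangle[of "x - centre k m" "centre k m - y"] by simp
  then show ?thesis
    using infnorm_le_of_mem_cell[OF assms(1)] infnorm_le_of_mem_cell[OF assms(2)]
      infnorm_sub[of y "centre k m"] by linarith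
qed

lemma closed_cell_0_0: "closed_cell 0 0 = cube (a + (\<chi> i. L / 2)) L"
proof -
  have "centre 0 0 = a + (\<chi> i. L / 2)"
    by (simp add: centre_def vec_eq_iff)
  then show ?thesis by simp
qed

text \<open>Averages, masses and mean oscillations do not distinguish a cell from the closed cube with the same
centre and side, for which the BMO condition and the maximal operator are formulated.\<close>

lemma closed_cell_minus_cell_null: "closed_cell k m - cell k m \<in> null_sets lebesgue"
proof -
  have "box (centre k m - (\<chi> i. side k / 2)) (centre k m + (\<chi> i. side k / 2)) \<subseteq> cell k m"
    by (auto simp: mem_box_cart cell_def centre_def algebra_simps less_imp_le)
  then have "closed_cell k m - cell k m \<subseteq>
    cbox (centre k m - (\<chi> i. side k / 2)) (centre k m + (\<chi> i. side k / 2))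
    - box (centre k m - (\<chi> i. side k / 2)) (centre k m + (\<chi> i. side k / 2))"
    by (auto simp: cube_def)
  moreover have "negligible (cbox (centre k m - (\<chi> i. side k / 2)) (centre k m + (\<chi> i. side k / 2))
    - box (centre k m - (\<chi> i. side k / 2)) (centre k m + (\<chi> i. side k / 2)))"
    by (rule negligible_frontier_interval)
  ultimately show ?thesis
    using negligible_subset negligible_iff_null_sets by blast
qed

lemma sets_lebesgue_cell [measurable, simp]: "cell k m \<in> sets lebesgue"
proof -
  have "cell k m = closed_cell k m - (closed_cell k m - cell k m)"
    using cell_subset_closed_cell by blast
  then show ?thesis
    using closed_cell_minus_cell_null[of k m] sets_lebesgue_cube
    by (metis null_setsD2 sets.Diff)
qed

lemma AE_closed_cell_iff: "AE x in lebesgue. x \<in> closed_cell k m \<longleftrightarrow> x \<in> cell k m"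
  by (rule AE_I'[OF closed_cell_minus_cell_null[of k m]]) (use cell_subset_closed_cell in auto)

lemma emeasure_cell: "emeasure lebesgue (cell k m) = ennreal (side k ^ CARD('n))"
proof -
  have "emeasure lebesgue (cell k m) = emeasure lebesgue (closed_cell k m)"
    by (rule emeasure_eq_AE) (use AE_closed_cell_iff[of k m] in auto)
  then show ?thesis
    by (simp only: emeasure_lebesgue_cube side_nonneg)
qed

lemma measure_cell: "measure lebesgue (cell k m) = side k ^ CARD('n)"
  by (simp add: measure_def emeasure_cell)

lemma lmeasurable_cell [simp]: "cell k m \<in> lmeasurable"
  by (rule fmeasurableI) (simp_all only: sets_lebesgue_cell emeasure_cell ennreal_less_top infinity_ennreal_def)

lemma nn_integral_closed_cell:
  "(\<integral>\<^sup>+x\<in>closed_cell k m. h x \<partial>lebesgue) = (\<integral>\<^sup>+x\<in>cell k m. h x \<partial>lebesgue)"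
  by (rule nn_integral_cong_AE) (use AE_closed_cell_iff[of k m] in \<open>auto simp: indicator_def\<close>)

lemma wmeas_closed_cell: "wmeas w (closed_cell k m) = wmeas w (cell k m)"
  unfolding wmeas_def by (rule nn_integral_closed_cell)

lemma avg_closed_cell:
  assumes "f \<in> borel_measurable lebesgue"
  shows "avg f (closed_cell k m) = avg f (cell k m)"
proof -
  have "(LINT x:closed_cell k m|lebesgue. f x) = (LINT x:cell k m|lebesgue. f x)"
    unfolding set_lebesgue_integral_def
    by (rule integral_cong_AE)
       (use AE_closed_cell_iff[of k m] assms in \<open>auto simp: indicator_def\<close>)
  then show ?thesis
    by (simp add: avg_def measure_cell measure_lebesgue_cube)
qed

lemma closed_cell_subset_anc:
  assumes "k \<le> j" shows "closed_cell j m \<subseteq> closed_cell k (anc j k m)"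
proof -
  have "closed_cell j m \<subseteq> closure (cell j m)"
  proof -
    have "box (centre j m - (\<chi> i. side j / 2)) (centre j m + (\<chi> i. side j / 2)) \<subseteq> cell j m"
      by (auto simp: mem_box_cart cell_def centre_def algebra_simps less_imp_le)
    moreover have "box (centre j m - (\<chi> i. side j / 2)) (centre j m + (\<chi> i. side j / 2)) \<noteq> {}"
      by (auto simp: interval_ne_empty_cart)
    ultimately show ?thesis
      using closure_mono closure_box by (metis cube_def)
  qed
  also have "\<dots> \<subseteq> closed_cell k (anc j k m)"
    using cell_subset_anc[OF assms, of m] cell_subset_closed_cell[of k "anc j k m"]
    by (intro closure_minimal compact_imp_closed) auto
  finally show ?thesis .
qed

lemma nn_integral_cell_children:
  assumes "h \<in> borel_measurable lebesgue"
  shows "(\<integral>\<^sup>+x\<in>cell k m. h x \<partial>lebesgue) = (\<Sum>m'\<in>children m. \<integral>\<^sup>+x\<in>cell (Suc k) m'. h x \<partial>lebesgue)"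
  by (subst cell_eq_Union_children, rule nn_integral_finite_Union_disjoint)
     (simp_all add: disjoint_cells assms)

lemma borel_measurable_cellwise [measurable]:
  fixes G :: "int^'n \<Rightarrow> 'b::topological_space"
  shows "(\<lambda>x. G (idx k x)) \<in> borel_measurable lebesgue"
proof (rule measurableI)
  fix A :: "'b set" assume "A \<in> sets borel"
  have "(\<lambda>x. G (idx k x)) -` A \<inter> space lebesgue = (\<Union>m\<in>{m. G m \<in> A}. cell k m)"
    by (auto simp: mem_cell_iff_idx)
  also have "\<dots> \<in> sets lebesgue"
    by (intro sets.countable_UN') (auto intro: countableI_type)
  finally show "(\<lambda>x. G (idx k x)) -` A \<inter> space lebesgue \<in> sets lebesgue" .
qed auto

text \<open>Comparing volumes bounds the number of disjoint cells inside a cube.\<close>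

lemma sum_volume_cells_le:
  assumes "finite I" "\<And>m. m \<in> I \<Longrightarrow> cell k m \<subseteq> cube c l" "0 \<le> l"
  shows "real (card I) * side k ^ CARD('n) \<le> l ^ CARD('n)"
proof -
  have "real (card I) * side k ^ CARD('n) = measure lebesgue (\<Union>m\<in>I. cell k m)"
    by (subst measure_UNION_AE[symmetric] measure_finite_Union[OF assms(1)])
       (auto simp: measure_cell emeasure_cell disjoint_cells)
  also have "\<dots> \<le> measure lebesgue (cube c l)"
    using assms by (intro measure_mono_fmeasurable) auto
  finally show ?thesis
    using assms by (simp add: measure_lebesgue_cube)
qed

lemma finite_cells_in_cube: "finite {m. cell k m \<subseteq> cube c l}"
proof (cases "l \<ge> 0")
  case True
  show ?thesis
  proof (rule ccontr)
    assume "infinite {m. cell k m \<subseteq> cube c l}"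
    moreover obtain N where "l ^ CARD('n) / side k ^ CARD('n) < real N"
      using reals_Archimedean2 by blast
    ultimately obtain I where "I \<subseteq> {m. cell k m \<subseteq> cube c l}" "finite I" "card I = N"
      using infinite_arbitrarily_large by blast
    then have "real N * side k ^ CARD('n) \<le> l ^ CARD('n)"
      using sum_volume_cells_le[of I k c l] True by auto
    then show False
      using \<open>l ^ CARD('n) / side k ^ CARD('n) < real N\<close> by (simp add: pos_divide_less_eq)
  qed
next
  case False
  note cell_nonempty
  moreover have "cube c l = {}"
    using False infnorm_pos_le by (auto simp: mem_cube_iff_infnorm) (smt (verit) infnorm_pos_le)
  ultimately show ?thesis by auto
qed

end

section \<open>Averages and mean oscillation\<close>

lemma osc_le_of_bmo_norm:
  fixes f :: "real^'n \<Rightarrow> real"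
  assumes "bmo_norm f \<le> ennreal K" "0 < l" "0 \<le> K"
  shows "(\<integral>\<^sup>+x\<in>cube c l. ennreal \<bar>f x - avg f (cube c l)\<bar> \<partial>lebesgue) \<le> ennreal (K * l ^ CARD('n))"
proof -
  have "(\<integral>\<^sup>+x\<in>cube c l. ennreal \<bar>f x - avg f (cube c l)\<bar> \<partial>lebesgue) / emeasure lebesgue (cube c l)
    \<le> bmo_norm f"
    unfolding bmo_norm_def using assms(2) by (intro SUP_upper2[of "(c, l)"]) auto
  also have "\<dots> \<le> ennreal K" by fact
  finally have *: "(\<integral>\<^sup>+x\<in>cube c l. ennreal \<bar>f x - avg f (cube c l)\<bar> \<partial>lebesgue) / ennreal (l ^ CARD('n)) \<le> ennreal K"
    unfolding emeasure_lebesgue_cube[OF less_imp_le[OF assms(2)]] .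
  then show ?thesis
    using assms(2,3) by (simp add: ennreal_divide_le_iff ennreal_mult)
qed

lemma avg_minus_const:
  fixes f :: "real^'n \<Rightarrow> real"
  assumes "set_integrable lebesgue E f" "E \<in> lmeasurable"
  shows "(LINT x:E|lebesgue. f x - b) = (avg f E - b) * measure lebesgue E"
proof -
  have const: "set_integrable lebesgue E (\<lambda>_. b)"
    using assms(2) by (simp add: set_integrable_def fmeasurable_def integrable_indicator_iff
        del: emeasure_completion)
  have "(LINT x:E|lebesgue. f x - b) = (LINT x:E|lebesgue. f x) - measure lebesgue E * b"
    using set_integral_diff(2)[OF assms(1) const] set_integral_const[of E lebesgue b] assms(2)
    by (simp add: fmeasurable_def less_top del: emeasure_completion)
  moreover have "(LINT x:E|lebesgue. f x) = avg f E * measure lebesgue E"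
  proof (cases "measure lebesgue E = 0")
    case True
    then have "E \<in> null_sets lebesgue"
      using assms(2) emeasure_eq_measure2[OF assms(2)]
      by (intro null_setsI) (simp_all add: fmeasurableD)
    then have "(LINT x:E|lebesgue. f x) = 0"
      unfolding set_lebesgue_integral_def
      by (intro integral_eq_zero_AE AE_I'[of E]) (auto simp: indicator_def)
    then show ?thesis using True by simp
  next
    case False
    then show ?thesis by (simp add: avg_def)
  qed
  ultimately show ?thesis
    by (simp add: algebra_simps)
qed

lemma abs_avg_minus_const_le:
  fixes f :: "real^'n \<Rightarrow> real"
  assumes "set_integrable lebesgue E f" "E \<in> lmeasurable"
  shows "ennreal (\<bar>avg f E - b\<bar> * measure lebesgue E) \<le> (\<integral>\<^sup>+x\<in>E. ennreal \<bar>f x - b\<bar> \<partial>lebesgue)"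
proof -
  have const: "set_integrable lebesgue E (\<lambda>_. b)"
    using assms(2) by (simp add: set_integrable_def fmeasurable_def integrable_indicator_iff
        del: emeasure_completion)
  have "integrable lebesgue (\<lambda>x. indicator E x *\<^sub>R (f x - b))"
    using set_integral_diff(1)[OF assms(1) const] by (simp only: set_integrable_def)
  from integral_norm_bound_ennreal[OF this]
  have "ennreal \<bar>LINT x:E|lebesgue. f x - b\<bar> \<le> (\<integral>\<^sup>+x. norm (indicator E x *\<^sub>R (f x - b)) \<partial>lebesgue)"
    by (simp add: set_lebesgue_integral_def)
  also have "\<dots> = (\<integral>\<^sup>+x\<in>E. ennreal \<bar>f x - b\<bar> \<partial>lebesgue)"
    by (intro nn_integral_cong) (auto simp: indicator_def)
  finally show ?thesis
    unfolding avg_minus_const[OF assms] by (simp add: abs_mult)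
qed

text \<open>A set that fills at least the fraction \<open>1/K\<close> of a cube sees at most \<open>K\<close> times the mean oscillation of the cube.\<close>

lemma abs_avg_diff_le:
  fixes f :: "real^'n \<Rightarrow> real"
  assumes "locally_integrable f" "bmo_norm f \<le> 1" "0 < l"
    and "E \<in> lmeasurable" "E \<subseteq> cube c l" "l ^ CARD('n) \<le> K * measure lebesgue E"
  shows "\<bar>avg f E - avg f (cube c l)\<bar> \<le> K"
proof -
  have "0 < l ^ CARD('n)" using assms(3) by simp
  then have pos: "0 < measure lebesgue E"
    using assms(6) measure_nonneg[of lebesgue E] by (cases "measure lebesgue E = 0") (auto simp: less_le)
  have "set_integrable lebesgue E f"
    using assms by (intro set_integrable_subset_cube[of f E c l]) auto
  from abs_avg_minus_const_le[OF this assms(4), of "avg f (cube c l)"]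
  have "ennreal (\<bar>avg f E - avg f (cube c l)\<bar> * measure lebesgue E)
      \<le> (\<integral>\<^sup>+x\<in>E. ennreal \<bar>f x - avg f (cube c l)\<bar> \<partial>lebesgue)" .
  also have "\<dots> \<le> (\<integral>\<^sup>+x\<in>cube c l. ennreal \<bar>f x - avg f (cube c l)\<bar> \<partial>lebesgue)"
    using assms(5) by (intro nn_integral_mono) (auto simp: indicator_def)
  also have "\<dots> \<le> ennreal (1 * l ^ CARD('n))"
    using assms by (intro osc_le_of_bmo_norm) auto
  finally have "\<bar>avg f E - avg f (cube c l)\<bar> * measure lebesgue E \<le> l ^ CARD('n)"
    using assms(3) by (simp add: ennreal_le_iff)
  also have "\<dots> \<le> K * measure lebesgue E" by fact
  finally show ?thesis
    using pos by simp
qed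

section \<open>Bounding the oscillation by the maximal function\<close>

context dyadic_grid
begin

text \<open>The supremum over the cells of the grid is measurable because it is constant on the cells of each
generation before the supremum is taken; so its integral is additive over children.\<close>

definition dyadic_maximal :: "(real^'n \<Rightarrow> real) \<Rightarrow> real^'n \<Rightarrow> ennreal" where
  "dyadic_maximal w x = (SUP k. wmeas w (cell k (idx k x)) / ennreal (side k ^ CARD('n)))"

lemma dyadic_maximal_measurable [measurable]: "dyadic_maximal w \<in> borel_measurable lebesgue"
  unfolding dyadic_maximal_def[abs_def]
  by (intro borel_measurable_SUP borel_measurable_cellwise) auto

lemma dyadic_maximal_ge:
  assumes "x \<in> cell k m"
  shows "wmeas w (cell k m) / ennreal (side k ^ CARD('n)) \<le> dyadic_maximal w x"
  unfolding dyadic_maximal_def using assms by (intro SUP_upper2[of k]) (auto simp: mem_cell_iff_idx)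

lemma wmeas_le_dyadic_maximal:
  "wmeas w (cell k m) \<le> (\<integral>\<^sup>+x\<in>cell k m. dyadic_maximal w x \<partial>lebesgue)"
proof -
  let ?V = "ennreal (side k ^ CARD('n))"
  have "wmeas w (cell k m) = wmeas w (cell k m) / ?V * ?V"
    by (simp add: ennreal_divide_times)
  also have "\<dots> = (\<integral>\<^sup>+x\<in>cell k m. wmeas w (cell k m) / ?V \<partial>lebesgue)"
    by (simp add: nn_integral_cmult_indicator emeasure_cell)
  also have "\<dots> \<le> (\<integral>\<^sup>+x\<in>cell k m. dyadic_maximal w x \<partial>lebesgue)"
    by (intro nn_integral_mono) (auto simp: indicator_def dyadic_maximal_ge)
  finally show ?thesis .
qed

lemma dyadic_maximal_le_maximal_op:
  assumes "x \<in> cell 0 m" "weight w"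
  shows "dyadic_maximal w x \<le> maximal_op (\<lambda>y. w y * indicator (closed_cell 0 m) y) x"
  unfolding dyadic_maximal_def
proof (rule SUP_least)
  fix k
  let ?m = "idx k x" and ?Q = "closed_cell 0 m"
  have "anc k 0 ?m = m"
    using assms(1) idx_eq_anc[of 0 k x] by (simp add: mem_cell_iff_idx)
  then have sub: "closed_cell k ?m \<subseteq> ?Q"
    using closed_cell_subset_anc[of 0 k ?m] by simp
  have "wmeas w (cell k ?m) = wmeas w (closed_cell k ?m)"
    by (simp only: wmeas_closed_cell)
  also have "\<dots> = (\<integral>\<^sup>+y\<in>closed_cell k ?m. ennreal \<bar>w y * indicator ?Q y\<bar> \<partial>lebesgue)"
    unfolding wmeas_def
    using sub by (intro nn_integral_cong) (auto simp: indicator_def weight_nonneg[OF assms(2)])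
  finally have "wmeas w (cell k ?m) / ennreal (side k ^ CARD('n)) =
    (\<integral>\<^sup>+y\<in>closed_cell k ?m. ennreal \<bar>w y * indicator ?Q y\<bar> \<partial>lebesgue) / emeasure lebesgue (closed_cell k ?m)"
    by (simp only: emeasure_lebesgue_cube side_nonneg)
  also have "\<dots> \<le> maximal_op (\<lambda>y. w y * indicator ?Q y) x"
    unfolding maximal_op_def
    using cell_subset_closed_cell[of k ?m]
    by (intro SUP_upper2[of "(centre k ?m, side k)"]) (auto simp: subset_iff)
  finally show "wmeas w (cell k ?m) / ennreal (side k ^ CARD('n)) \<le> maximal_op (\<lambda>y. w y * indicator ?Q y) x" .
qed

lemma wmeas_cell_finite: "weight w \<Longrightarrow> wmeas w (cell k m) < \<infinity>"
  by (rule wmeas_subset_cube_finite[OF _ cell_subset_closed_cell])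

lemma avg_cell_osc:
  assumes "locally_integrable f" "bmo_norm f \<le> 1"
  shows "(\<integral>\<^sup>+x\<in>cell k m. ennreal \<bar>f x - avg f (cell k m)\<bar> \<partial>lebesgue) \<le> ennreal (side k ^ CARD('n))"
proof -
  have "(\<integral>\<^sup>+x\<in>closed_cell k m. ennreal \<bar>f x - avg f (closed_cell k m)\<bar> \<partial>lebesgue) \<le> ennreal (1 * side k ^ CARD('n))"
    using assms by (intro osc_le_of_bmo_norm) auto
  then show ?thesis
    using avg_closed_cell[OF locally_integrable_borel_measurable[OF assms(1)]]
    by (simp add: nn_integral_closed_cell)
qed

lemma avg_cell_child_diff:
  assumes "locally_integrable f" "bmo_norm f \<le> 1" "m' \<in> children m"
  shows "\<bar>avg f (cell (Suc k) m') - avg f (cell k m)\<bar> \<le> 2 ^ CARD('n)"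
proof -
  have "cell (Suc k) m' \<subseteq> closed_cell k m"
    using assms(3) cell_eq_Union_children[of k m] cell_subset_closed_cell[of k m] by blast
  then have "\<bar>avg f (cell (Suc k) m') - avg f (closed_cell k m)\<bar> \<le> 2 ^ CARD('n)"
    using assms by (intro abs_avg_diff_le) (auto simp: measure_cell side_Suc power_divide)
  then show ?thesis
    using avg_closed_cell[OF locally_integrable_borel_measurable[OF assms(1)]] by simp
qed

lemma set_integrable_cell: "locally_integrable f \<Longrightarrow> set_integrable lebesgue (cell k m) f"
  by (rule set_integrable_subset_cube[OF _ _ cell_subset_closed_cell]) auto

text \<open>The induction behind the first inequality.  Here \<open>b\<close> is the current reference value and \<open>\<theta>\<close> the average
of \<open>w\<close> over the cell of the last restart.  Apart from the two terms that dominate the oscillation of the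
averages, the inequality carries the balance \<open>C \<theta> (\<bar>P\<bar> - (\<integral>\<^sub>P \<bar>f - b\<bar>) / 2)\<close>.  Right after a restart on
\<open>P\<close> the balance is at least \<open>C w(P) / 2\<close>, since then \<open>b = f\<^sub>P\<close>, \<open>\<theta> \<bar>P\<bar> = w(P)\<close> and the mean oscillation is
at most \<open>1\<close>; this pays for the jump of the reference value, at most \<open>2 + 2^n\<close>, times \<open>w(P)\<close>.  On a cell where the
average has moved away from \<open>b\<close> by more than \<open>2\<close> the balance is at most \<open>0\<close>, so that it can be
discarded there and a new run can be started.\<close>

lemma avg_oscillation_recursion:
  fixes f w :: "real^'n \<Rightarrow> real"
  assumes f: "locally_integrable f" "bmo_norm f \<le> 1" and w: "weight w"
    and "\<bar>avg f (cell k m) - b\<bar> \<le> 2" "0 \<le> \<theta>"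
  defines "C \<equiv> 2 * (2 + 2 ^ CARD('n)) :: real"
  shows "(\<integral>\<^sup>+x\<in>cell k m. ennreal (\<bar>avg f (cell (k + d) (idx (k + d) x)) - b\<bar> * w x) \<partial>lebesgue)
      + (\<integral>\<^sup>+x\<in>cell k m. ennreal (C * \<theta>) \<partial>lebesgue)
    \<le> 2 * wmeas w (cell k m)
      + ennreal C * (\<integral>\<^sup>+x\<in>cell k m. max (dyadic_maximal w x) (ennreal \<theta>) \<partial>lebesgue)
      + ennreal (C * \<theta> / 2) * (\<integral>\<^sup>+x\<in>cell k m. ennreal \<bar>f x - b\<bar> \<partial>lebesgue)"
  using assms(4,5)
proof (induction d arbitrary: k m b \<theta>)
  case 0
  have C: "0 \<le> C" by (simp add: C_def)
  note [measurable] = weight_borel_measurable[OF w] locally_integrable_borel_measurable[OF f(1)]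
  have "(\<integral>\<^sup>+x\<in>cell k m. ennreal (\<bar>avg f (cell (k + 0) (idx (k + 0) x)) - b\<bar> * w x) \<partial>lebesgue)
      \<le> (\<integral>\<^sup>+x. 2 * (ennreal (w x) * indicator (cell k m) x) \<partial>lebesgue)"
  proof (intro nn_integral_mono)
    fix x
    have "\<bar>avg f (cell k m) - b\<bar> * w x \<le> 2 * w x"
      using 0 weight_nonneg[OF w] by (intro mult_right_mono) auto
    then have "ennreal (\<bar>avg f (cell k m) - b\<bar> * w x) \<le> ennreal (2 * w x)"
      by (rule ennreal_leI)
    then show "ennreal (\<bar>avg f (cell (k + 0) (idx (k + 0) x)) - b\<bar> * w x) * indicator (cell k m) x
      \<le> 2 * (ennreal (w x) * indicator (cell k m) x)"
      using weight_nonneg[OF w, of x]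
      by (auto simp: indicator_def mem_cell_iff_idx ennreal_mult)
  qed
  also have "\<dots> = 2 * wmeas w (cell k m)"
    unfolding wmeas_def by (intro nn_integral_cmult) measurable
  finally have 1: "(\<integral>\<^sup>+x\<in>cell k m. ennreal (\<bar>avg f (cell (k + 0) (idx (k + 0) x)) - b\<bar> * w x) \<partial>lebesgue)
    \<le> 2 * wmeas w (cell k m)" .
  have "(\<integral>\<^sup>+x\<in>cell k m. ennreal (C * \<theta>) \<partial>lebesgue)
    \<le> (\<integral>\<^sup>+x. ennreal C * (max (dyadic_maximal w x) (ennreal \<theta>) * indicator (cell k m) x) \<partial>lebesgue)"
    using C 0 by (intro nn_integral_mono) (auto simp: indicator_def ennreal_mult intro!: mult_left_mono)
  also have "\<dots> = ennreal C * (\<integral>\<^sup>+x\<in>cell k m. max (dyadic_maximal w x) (ennreal \<theta>) \<partial>lebesgue)"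
    by (intro nn_integral_cmult) measurable
  finally have 2: "(\<integral>\<^sup>+x\<in>cell k m. ennreal (C * \<theta>) \<partial>lebesgue)
     \<le> ennreal C * (\<integral>\<^sup>+x\<in>cell k m. max (dyadic_maximal w x) (ennreal \<theta>) \<partial>lebesgue)" .
  show ?case
    using add_mono[OF 1 2] by (rule order_trans) simp
next
  case (Suc d)
  let ?K = "Suc k"
  let ?X = "\<lambda>b m'. \<integral>\<^sup>+x\<in>cell ?K m'. ennreal (\<bar>avg f (cell (?K + d) (idx (?K + d) x)) - b\<bar> * w x) \<partial>lebesgue"
  let ?T = "\<lambda>\<theta> m'. \<integral>\<^sup>+x\<in>cell ?K m'. ennreal (C * \<theta>) \<partial>lebesgue"
  let ?I = "\<lambda>\<theta> m'. \<integral>\<^sup>+x\<in>cell ?K m'. max (dyadic_maximal w x) (ennreal \<theta>) \<partial>lebesgue"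
  let ?O = "\<lambda>b m'. \<integral>\<^sup>+x\<in>cell ?K m'. ennreal \<bar>f x - b\<bar> \<partial>lebesgue"
  let ?V = "side ?K ^ CARD('n)"
  note [measurable] = weight_borel_measurable[OF w] locally_integrable_borel_measurable[OF f(1)]
  have C: "0 \<le> C" by (simp add: C_def)
  have V: "0 < ?V" by simp
  have child: "?X b m' + ?T \<theta> m' \<le> 2 * wmeas w (cell ?K m') + ennreal C * ?I \<theta> m'
      + ennreal (C * \<theta> / 2) * ?O b m'" if m': "m' \<in> children m" for m'
  proof (cases "\<bar>avg f (cell ?K m') - b\<bar> \<le> 2")
    case True
    then show ?thesis using Suc by blast
  next
    case False
    define b' where "b' = avg f (cell ?K m')"
    obtain W where W: "wmeas w (cell ?K m') = ennreal W" "0 \<le> W"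
      using wmeas_cell_finite[OF w, of ?K m'] by (cases "wmeas w (cell ?K m')") auto
    define \<theta>' where "\<theta>' = W / ?V"
    have \<theta>': "0 \<le> \<theta>'" "\<theta>' * ?V = W"
      using V W(2) by (auto simp: \<theta>'_def)
    \<comment> \<open>the maximal function already exceeds \<open>\<theta>'\<close> on this cell, so the new level needs no extra room\<close>
    have I_le: "?I \<theta>' m' \<le> ?I \<theta> m'"
    proof (intro nn_integral_mono)
      fix x
      have "ennreal \<theta>' \<le> dyadic_maximal w x" if "x \<in> cell ?K m'"
        using dyadic_maximal_ge[OF that, of w] W V by (simp add: \<theta>'_def divide_ennreal)
      then show "max (dyadic_maximal w x) (ennreal \<theta>') * indicator (cell ?K m') x
        \<le> max (dyadic_maximal w x) (ennreal \<theta>) * indicator (cell ?K m') x"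
        by (auto simp: indicator_def max_def)
    qed
    have T': "?T \<theta>' m' = ennreal (C * W)"
      using C \<theta>' V by (simp add: nn_integral_cmult_indicator emeasure_cell ennreal_mult[symmetric] mult.assoc)
    have "?X b' m' + ?T \<theta>' m' \<le> 2 * wmeas w (cell ?K m') + ennreal C * ?I \<theta>' m'
      + ennreal (C * \<theta>' / 2) * ?O b' m'"
      by (rule Suc.IH) (simp_all add: b'_def \<theta>')
    also have "\<dots> \<le> 2 * wmeas w (cell ?K m') + ennreal C * ?I \<theta> m' + ennreal (C * \<theta>' / 2) * ennreal ?V"
      unfolding b'_def by (intro add_mono mult_left_mono I_le avg_cell_osc f) auto
    also have "ennreal (C * \<theta>' / 2) * ennreal ?V = ennreal (C / 2 * W)"
      using C \<theta>' V by (simp add: ennreal_mult[symmetric] mult.assoc[symmetric])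
        (simp add: mult.assoc)
    finally have charged: "?X b' m' + ?T \<theta>' m'
      \<le> 2 * wmeas w (cell ?K m') + ennreal C * ?I \<theta> m' + ennreal (C / 2 * W)" .
    have "?T \<theta>' m' = ennreal (C / 2 * W) + ennreal (C / 2 * W)"
      unfolding T' using C W(2) by (simp add: ennreal_plus[symmetric] del: ennreal_plus)
    with charged have "ennreal (C / 2 * W) + (?X b' m' + ennreal (C / 2 * W))
      \<le> ennreal (C / 2 * W) + (2 * wmeas w (cell ?K m') + ennreal C * ?I \<theta> m')"
      by (simp only: ac_simps)
    then have Y: "?X b' m' + ennreal (C / 2 * W) \<le> 2 * wmeas w (cell ?K m') + ennreal C * ?I \<theta> m'"
      unfolding ennreal_add_left_cancel_le by (simp only: ennreal_neq_top infinity_ennreal_def simp_thms)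
    have "C / 2 = 2 + 2 ^ CARD('n)"
      by (simp add: C_def)
    then have jump: "\<bar>b' - b\<bar> \<le> C / 2"
      using avg_cell_child_diff[OF f m', of k] Suc.prems(1) unfolding b'_def by linarith
    have "?X b m' \<le> (\<integral>\<^sup>+x. ennreal (\<bar>avg f (cell (?K + d) (idx (?K + d) x)) - b'\<bar> * w x) * indicator (cell ?K m') x
        + ennreal (C / 2) * (ennreal (w x) * indicator (cell ?K m') x) \<partial>lebesgue)"
    proof (intro nn_integral_mono)
      fix x
      let ?p = "avg f (cell (?K + d) (idx (?K + d) x))"
      have "\<bar>?p - b\<bar> * w x \<le> (\<bar>?p - b'\<bar> + C / 2) * w x"
        by (rule mult_right_mono) (use jump weight_nonneg[OF w, of x] in linarith)+
      also have "\<dots> = \<bar>?p - b'\<bar> * w x + C / 2 * w x"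
        by (simp add: algebra_simps)
      finally have "ennreal (\<bar>?p - b\<bar> * w x) \<le> ennreal (\<bar>?p - b'\<bar> * w x) + ennreal (C / 2) * ennreal (w x)"
        using C weight_nonneg[OF w, of x]
        by (simp add: ennreal_plus[symmetric] ennreal_mult[symmetric] del: ennreal_plus)
      then show "ennreal (\<bar>?p - b\<bar> * w x) * indicator (cell ?K m') x \<le>
        ennreal (\<bar>?p - b'\<bar> * w x) * indicator (cell ?K m') x
        + ennreal (C / 2) * (ennreal (w x) * indicator (cell ?K m') x)"
        by (auto simp: indicator_def)
    qed
    also have "\<dots> = ?X b' m' + ennreal (C / 2) * wmeas w (cell ?K m')"
      unfolding wmeas_def
      by (subst nn_integral_add) (measurable, simp add: nn_integral_cmult)
    also have "\<dots> = ?X b' m' + ennreal (C / 2 * W)"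
      using C W by (simp add: ennreal_mult[symmetric])
    also note Y
    finally have X: "?X b m' \<le> 2 * wmeas w (cell ?K m') + ennreal C * ?I \<theta> m'" .
    \<comment> \<open>the old balance is at most \<open>0\<close> here and is given up\<close>
    have "2 * ?V \<le> \<bar>b' - b\<bar> * ?V"
      using False V unfolding b'_def by (intro mult_right_mono) auto
    then have "ennreal (2 * ?V) \<le> ennreal (\<bar>b' - b\<bar> * ?V)"
      by (rule ennreal_leI)
    also have "\<dots> \<le> ?O b m'"
      using abs_avg_minus_const_le[OF set_integrable_cell[OF f(1)] lmeasurable_cell, of ?K m' b]
      by (simp add: b'_def measure_cell)
    finally have "ennreal (C * \<theta> / 2) * ennreal (2 * ?V) \<le> ennreal (C * \<theta> / 2) * ?O b m'"
      by (intro mult_left_mono) auto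
    moreover have "ennreal (C * \<theta> / 2) * ennreal (2 * ?V) = ?T \<theta> m'"
      using C Suc.prems(2) V
      by (simp add: nn_integral_cmult_indicator emeasure_cell ennreal_mult[symmetric])
    ultimately show ?thesis
      using X by (simp add: add_mono)
  qed
  have split: "(\<integral>\<^sup>+x\<in>cell k m. ennreal (\<bar>avg f (cell (k + Suc d) (idx (k + Suc d) x)) - b\<bar> * w x) \<partial>lebesgue)
        = (\<Sum>m'\<in>children m. ?X b m')"
      "(\<integral>\<^sup>+x\<in>cell k m. ennreal (C * \<theta>) \<partial>lebesgue) = (\<Sum>m'\<in>children m. ?T \<theta> m')"
      "wmeas w (cell k m) = (\<Sum>m'\<in>children m. wmeas w (cell ?K m'))"
      "(\<integral>\<^sup>+x\<in>cell k m. max (dyadic_maximal w x) (ennreal \<theta>) \<partial>lebesgue) = (\<Sum>m'\<in>children m. ?I \<theta> m')"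
      "(\<integral>\<^sup>+x\<in>cell k m. ennreal \<bar>f x - b\<bar> \<partial>lebesgue) = (\<Sum>m'\<in>children m. ?O b m')"
    unfolding wmeas_def add_Suc_shift by (rule nn_integral_cell_children, measurable)+
  show ?case
    unfolding split sum_distrib_left sum.distrib[symmetric]
    by (intro sum_mono child)
qed

lemma avg_oscillation_le:
  fixes f w :: "real^'n \<Rightarrow> real"
  assumes f: "locally_integrable f" "bmo_norm f \<le> 1" and w: "weight w"
  defines "C \<equiv> 2 * (2 + 2 ^ CARD('n)) :: real"
  shows "(\<integral>\<^sup>+x\<in>cell k m. ennreal (\<bar>avg f (cell (k + d) (idx (k + d) x)) - avg f (cell k m)\<bar> * w x) \<partial>lebesgue)
    \<le> ennreal (2 + C) * (\<integral>\<^sup>+x\<in>cell k m. dyadic_maximal w x \<partial>lebesgue)"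
proof -
  have C: "0 \<le> C" by (simp add: C_def)
  have "(\<integral>\<^sup>+x\<in>cell k m. ennreal (\<bar>avg f (cell (k + d) (idx (k + d) x)) - avg f (cell k m)\<bar> * w x) \<partial>lebesgue)
    \<le> 2 * wmeas w (cell k m) + ennreal C * (\<integral>\<^sup>+x\<in>cell k m. dyadic_maximal w x \<partial>lebesgue)"
    using avg_oscillation_recursion[OF f w, of k m "avg f (cell k m)" 0 d] by (simp add: C_def)
  also have "\<dots> \<le> 2 * (\<integral>\<^sup>+x\<in>cell k m. dyadic_maximal w x \<partial>lebesgue) + ennreal C * (\<integral>\<^sup>+x\<in>cell k m. dyadic_maximal w x \<partial>lebesgue)"
    by (intro add_mono mult_left_mono wmeas_le_dyadic_maximal) auto
  also have "\<dots> = ennreal (2 + C) * (\<integral>\<^sup>+x\<in>cell k m. dyadic_maximal w x \<partial>lebesgue)"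
    using C by (simp add: distrib_right)
  finally show ?thesis .
qed

text \<open>For almost every \<open>x\<close> the averages over the cubes with lower corner \<open>x\<close> converge to \<open>f x\<close>.  The average over
such a cube differs from the average over the dyadic cell of \<open>x\<close> of the same side by at most \<open>2 * 2^n\<close>,
because both sets lie in one cube of twice the side.  A bounded error is enough: it only adds a multiple of
\<open>w(Q)\<close>.\<close>

lemma avg_cell_eventually_near:
  fixes f :: "real^'n \<Rightarrow> real"
  assumes f: "locally_integrable f" "bmo_norm f \<le> 1"
  shows "AE x in lebesgue. \<forall>\<^sub>F k in sequentially. \<bar>f x - avg f (cell k (idx k x))\<bar> \<le> 2 * 2 ^ CARD('n) + 1"
proof -
  have "f integrable_on cbox u v" for u v
    using f(1) unfolding locally_integrable_def by (meson compact_cbox set_lebesgue_integral_eq_integral(1))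
  then obtain N where N: "negligible N"
    and lim: "\<And>x e. x \<notin> N \<Longrightarrow> 0 < e \<Longrightarrow> \<exists>d>0. \<forall>h. 0 < h \<and> h < d \<longrightarrow>
        norm (integral (cbox x (x + h *\<^sub>R One)) f /\<^sub>R h ^ DIM(real^'n) - f x) < e"
    using integrable_ccontinuous_explicit[of f] by metis
  have "\<forall>\<^sub>F k in sequentially. \<bar>f x - avg f (cell k (idx k x))\<bar> \<le> 2 * 2 ^ CARD('n) + 1" if x: "x \<notin> N" for x
  proof -
    obtain d where d: "0 < d" and
      lim_d: "\<And>h. 0 < h \<Longrightarrow> h < d \<Longrightarrow> \<bar>integral (cbox x (x + h *\<^sub>R One)) f / h ^ CARD('n) - f x\<bar> < 1"
      using lim[OF x, of 1] by (auto simp: divide_inverse_commute)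
    from side_eventually_less[OF d] show ?thesis
    proof eventually_elim
      fix k assume h: "side k < d"
      let ?R = "cube x (2 * side k)" and ?K = "cbox x (x + side k *\<^sub>R One)" and ?D = "cell k (idx k x)"
      have K_eq: "?K = cube (x + (\<chi> i. side k / 2)) (side k)"
        by (rule corner_cube_eq_cube)
      have "infnorm ((\<chi> i. side k / 2) :: real^'n) \<le> side k / 2"
        unfolding infnorm_le_iff_cart by simp
      then have "?K \<subseteq> ?R"
        unfolding K_eq by (intro cube_subset_cube) simp
      then have 1: "\<bar>avg f ?K - avg f ?R\<bar> \<le> 2 ^ CARD('n)"
        by (intro abs_avg_diff_le f) (auto simp: K_eq measure_lebesgue_cube power_mult_distrib)
      have "?D \<subseteq> ?R"
      proof
        fix y assume "y \<in> ?D"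
        then have y: "infnorm (y - centre k (idx k x)) \<le> side k / 2"
          by (rule subsetD[OF cell_subset_closed_cell, unfolded mem_cube_iff_infnorm])
        have x: "infnorm (x - centre k (idx k x)) \<le> side k / 2"
          by (rule subsetD[OF cell_subset_closed_cell mem_cell_idx, unfolded mem_cube_iff_infnorm])
        have "infnorm (y - x) \<le> infnorm (y - centre k (idx k x)) + infnorm (centre k (idx k x) - x)"
          using infnorm_triangle[of "y - centre k (idx k x)" "centre k (idx k x) - x"] by simp
        also have "\<dots> \<le> side k"
          using x y infnorm_sub[of x] by simp
        finally show "y \<in> ?R"
          by (simp add: mem_cube_iff_infnorm)
      qed
      then have 2: "\<bar>avg f ?D - avg f ?R\<bar> \<le> 2 ^ CARD('n)"
        by (intro abs_avg_diff_le f) (auto simp: measure_cell power_mult_distrib)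
      have "avg f ?K = integral ?K f / side k ^ CARD('n)"
        using set_lebesgue_integral_eq_integral(2)[OF locally_integrable_set_integrable[OF f(1)]]
        by (simp add: avg_def K_eq measure_lebesgue_cube)
      then have "\<bar>avg f ?K - f x\<bar> < 1"
        using lim_d[OF _ h] by simp
      then show "\<bar>f x - avg f ?D\<bar> \<le> 2 * 2 ^ CARD('n) + 1"
        using 1 2 by linarith
    qed
  qed
  then show ?thesis
    using N by (intro AE_I'[of N]) (auto simp: negligible_iff_null_sets)
qed

text \<open>Fatou's lemma turns the uniform bound for the dyadic averages of \<open>f\<close> into a bound for \<open>f\<close>.\<close>

lemma oscillation_le_dyadic_maximal:
  fixes f w :: "real^'n \<Rightarrow> real"
  assumes f: "locally_integrable f" "bmo_norm f \<le> 1" and w: "weight w"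
  shows "(\<integral>\<^sup>+x\<in>cell 0 m. ennreal (\<bar>f x - avg f (cell 0 m)\<bar> * w x) \<partial>lebesgue)
    \<le> ennreal (7 + 4 * 2 ^ CARD('n)) * (\<integral>\<^sup>+x\<in>cell 0 m. dyadic_maximal w x \<partial>lebesgue)"
proof -
  let ?b = "avg f (cell 0 m)" and ?c = "2 * 2 ^ CARD('n) + 1 :: real" and ?C = "2 * (2 + 2 ^ CARD('n)) :: real"
  let ?M = "\<integral>\<^sup>+x\<in>cell 0 m. dyadic_maximal w x \<partial>lebesgue"
  let ?u = "\<lambda>k x. ennreal (\<bar>avg f (cell k (idx k x)) - ?b\<bar> * w x) * indicator (cell 0 m) x
    + ennreal ?c * (ennreal (w x) * indicator (cell 0 m) x)"
  note [measurable] = weight_borel_measurable[OF w] locally_integrable_borel_measurable[OF f(1)]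
  have "(\<integral>\<^sup>+x\<in>cell 0 m. ennreal (\<bar>f x - ?b\<bar> * w x) \<partial>lebesgue) \<le> (\<integral>\<^sup>+x. liminf (\<lambda>k. ?u k x) \<partial>lebesgue)"
  proof (intro nn_integral_mono_AE)
    show "AE x in lebesgue. ennreal (\<bar>f x - ?b\<bar> * w x) * indicator (cell 0 m) x \<le> liminf (\<lambda>k. ?u k x)"
      using avg_cell_eventually_near[OF f]
    proof eventually_elim
      fix x assume "\<forall>\<^sub>F k in sequentially. \<bar>f x - avg f (cell k (idx k x))\<bar> \<le> ?c"
      then have "\<forall>\<^sub>F k in sequentially. ennreal (\<bar>f x - ?b\<bar> * w x) * indicator (cell 0 m) x \<le> ?u k x"
      proof eventually_elim
        fix k assume near: "\<bar>f x - avg f (cell k (idx k x))\<bar> \<le> ?c"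
        let ?p = "avg f (cell k (idx k x))"
        have "\<bar>f x - ?b\<bar> * w x \<le> (\<bar>?p - ?b\<bar> + ?c) * w x"
          using near weight_nonneg[OF w, of x] by (intro mult_right_mono) auto
        also have "\<dots> = \<bar>?p - ?b\<bar> * w x + ?c * w x"
          by (simp add: algebra_simps)
        finally have "ennreal (\<bar>f x - ?b\<bar> * w x) \<le> ennreal (\<bar>?p - ?b\<bar> * w x) + ennreal ?c * ennreal (w x)"
          using weight_nonneg[OF w, of x]
          by (simp add: ennreal_plus[symmetric] ennreal_mult[symmetric] del: ennreal_plus)
        then show "ennreal (\<bar>f x - ?b\<bar> * w x) * indicator (cell 0 m) x \<le> ?u k x"
          by (auto simp: indicator_def)
      qed
      then show "ennreal (\<bar>f x - ?b\<bar> * w x) * indicator (cell 0 m) x \<le> liminf (\<lambda>k. ?u k x)"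
        by (rule Liminf_bounded)
    qed
  qed
  also have "\<dots> \<le> liminf (\<lambda>k. \<integral>\<^sup>+x. ?u k x \<partial>lebesgue)"
    by (intro nn_integral_liminf) measurable
  also have "\<dots> \<le> ennreal (2 + ?C) * ?M + ennreal ?c * ?M"
  proof (intro Liminf_le always_eventually allI)
    fix k
    have "(\<integral>\<^sup>+x. ?u k x \<partial>lebesgue)
      = (\<integral>\<^sup>+x\<in>cell 0 m. ennreal (\<bar>avg f (cell k (idx k x)) - ?b\<bar> * w x) \<partial>lebesgue)
        + ennreal ?c * wmeas w (cell 0 m)"
      unfolding wmeas_def
      by (subst nn_integral_add) (measurable, simp add: nn_integral_cmult)
    also have "\<dots> \<le> ennreal (2 + ?C) * ?M + ennreal ?c * ?M"
      using avg_oscillation_le[OF f w, of 0 k m]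
      by (intro add_mono mult_left_mono wmeas_le_dyadic_maximal) auto
    finally show "(\<integral>\<^sup>+x. ?u k x \<partial>lebesgue) \<le> ennreal (2 + ?C) * ?M + ennreal ?c * ?M" .
  qed simp
  also have "\<dots> = ennreal (7 + 4 * 2 ^ CARD('n)) * ?M"
    by (simp add: distrib_right[symmetric] ennreal_plus[symmetric] add.commute del: ennreal_plus)
  finally show ?thesis .
qed

end

theorem oscillation_le_maximal:
  fixes f w :: "real^'n \<Rightarrow> real"
  assumes f: "locally_integrable f" "bmo_norm f \<le> 1" and w: "weight w" and l: "0 < l"
  shows "(\<integral>\<^sup>+x\<in>cube c l. ennreal (\<bar>f x - avg f (cube c l)\<bar> * w x) \<partial>lebesgue)
    \<le> ennreal (7 + 4 * 2 ^ CARD('n))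
      * (\<integral>\<^sup>+x\<in>cube c l. maximal_op (\<lambda>y. w y * indicator (cube c l) y) x \<partial>lebesgue)"
proof -
  interpret dyadic_grid "c - (\<chi> i. l / 2)" l
    by unfold_locales (rule l)
  have Q: "cube c l = closed_cell 0 0"
    using closed_cell_0_0 by simp
  have "(\<integral>\<^sup>+x\<in>closed_cell 0 0. ennreal (\<bar>f x - avg f (closed_cell 0 0)\<bar> * w x) \<partial>lebesgue)
    \<le> ennreal (7 + 4 * 2 ^ CARD('n)) * (\<integral>\<^sup>+x\<in>cell 0 0. dyadic_maximal w x \<partial>lebesgue)"
    unfolding nn_integral_closed_cell avg_closed_cell[OF locally_integrable_borel_measurable[OF f(1)]]
    by (rule oscillation_le_dyadic_maximal[OF f w])
  also have "(\<integral>\<^sup>+x\<in>cell 0 0. dyadic_maximal w x \<partial>lebesgue)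
    \<le> (\<integral>\<^sup>+x\<in>cell 0 0. maximal_op (\<lambda>y. w y * indicator (closed_cell 0 0) y) x \<partial>lebesgue)"
    by (intro nn_integral_mono mult_right_mono_indicator dyadic_maximal_le_maximal_op w)
  finally show ?thesis
    unfolding Q nn_integral_closed_cell by (simp add: mult_left_mono)
qed

section \<open>Sums of tents over packed families of cells\<close>

text \<open>Any constant may replace the average in the definition of the BMO norm, at the price of a factor \<open>2\<close>.\<close>

lemma bmo_norm_leI:
  fixes f :: "real^'n \<Rightarrow> real"
  assumes f: "locally_integrable f" and B: "0 \<le> B"
    and osc: "\<And>c l. 0 < l \<Longrightarrow> \<exists>b. (\<integral>\<^sup>+x\<in>cube c l. ennreal \<bar>f x - b\<bar> \<partial>lebesgue) \<le> ennreal (B * l ^ CARD('n))"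
  shows "bmo_norm f \<le> ennreal (2 * B)"
  unfolding bmo_norm_def
proof (rule SUP_least, clarify)
  fix c :: "real^'n" and l :: real assume l: "0 < l"
  note [measurable] = locally_integrable_borel_measurable[OF f]
  obtain b where b: "(\<integral>\<^sup>+x\<in>cube c l. ennreal \<bar>f x - b\<bar> \<partial>lebesgue) \<le> ennreal (B * l ^ CARD('n))"
    using osc[OF l] by blast
  let ?a = "avg f (cube c l)" and ?V = "l ^ CARD('n)"
  have V: "0 < ?V" using l by simp
  have "ennreal (\<bar>?a - b\<bar> * ?V) \<le> ennreal (B * ?V)"
    using abs_avg_minus_const_le[OF locally_integrable_set_integrable[OF f] lmeasurable_cube, of c l b] b l
    by (simp add: measure_lebesgue_cube)
  then have "\<bar>?a - b\<bar> * ?V \<le> B * ?V"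
    using B V by (subst (asm) ennreal_le_iff) auto
  then have ab: "\<bar>?a - b\<bar> \<le> B"
    using V by simp
  have "(\<integral>\<^sup>+x\<in>cube c l. ennreal \<bar>f x - ?a\<bar> \<partial>lebesgue)
      \<le> (\<integral>\<^sup>+x. ennreal \<bar>f x - b\<bar> * indicator (cube c l) x + ennreal B * indicator (cube c l) x \<partial>lebesgue)"
  proof (intro nn_integral_mono)
    fix x
    have "\<bar>f x - ?a\<bar> \<le> \<bar>f x - b\<bar> + B"
      using ab by linarith
    then have "ennreal \<bar>f x - ?a\<bar> \<le> ennreal \<bar>f x - b\<bar> + ennreal B"
      using B by (simp add: ennreal_plus[symmetric] ennreal_leI del: ennreal_plus)
    then show "ennreal \<bar>f x - ?a\<bar> * indicator (cube c l) x
      \<le> ennreal \<bar>f x - b\<bar> * indicator (cube c l) x + ennreal B * indicator (cube c l) x"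
      by (auto simp: indicator_def)
  qed
  also have "\<dots> = (\<integral>\<^sup>+x\<in>cube c l. ennreal \<bar>f x - b\<bar> \<partial>lebesgue) + ennreal B * emeasure lebesgue (cube c l)"
    by (subst nn_integral_add) (auto simp: nn_integral_cmult_indicator simp del: emeasure_completion)
  also have "\<dots> \<le> ennreal (B * ?V) + ennreal B * ennreal ?V"
    using b l by (intro add_mono) (simp_all add: emeasure_lebesgue_cube del: emeasure_completion)
  also have "\<dots> = ennreal (2 * B) * ennreal ?V"
    using B V by (simp add: ennreal_mult[symmetric] ennreal_plus[symmetric] del: ennreal_plus)
  finally show "(\<integral>\<^sup>+x\<in>cube c l. ennreal \<bar>f x - ?a\<bar> \<partial>lebesgue) / emeasure lebesgue (cube c l) \<le> ennreal (2 * B)"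
    unfolding emeasure_lebesgue_cube[OF less_imp_le[OF l]]
    using V by (subst ennreal_divide_le_iff) auto
qed

text \<open>A Lipschitz substitute for the indicator of a cube: an indicator is bounded, but a sum of
indicators of packed dyadic cells is only of dyadic BMO, as it may jump across the boundary of a large cell.\<close>

definition tent :: "real^'n \<Rightarrow> real \<Rightarrow> real^'n \<Rightarrow> real" where
  "tent c s x = max 0 (2 - 2 * infnorm (x - c) / s)"

lemma tent_nonneg [simp]: "0 \<le> tent c s x"
  by (simp add: tent_def)

lemma tent_ge_1: "0 < s \<Longrightarrow> x \<in> cube c s \<Longrightarrow> 1 \<le> tent c s x"
  by (simp add: tent_def mem_cube_iff_infnorm le_max_iff_disj pos_divide_le_eq)

lemma tent_le_2: "0 < s \<Longrightarrow> tent c s x \<le> 2"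
  by (simp add: tent_def infnorm_pos_le)

lemma tent_eq_0: "0 < s \<Longrightarrow> x \<notin> cube c (2 * s) \<Longrightarrow> tent c s x = 0"
  by (simp add: tent_def mem_cube_iff_infnorm max_absorb1 pos_le_divide_eq)

lemma tent_Lipschitz:
  assumes "0 < s"
  shows "\<bar>tent c s x - tent c s y\<bar> \<le> 2 * infnorm (x - y) / s"
proof -
  have "\<bar>tent c s x - tent c s y\<bar> \<le> \<bar>2 * infnorm (x - c) / s - 2 * infnorm (y - c) / s\<bar>"
  proof -
    have "\<bar>max 0 (2 - u) - max 0 (2 - v)\<bar> \<le> \<bar>u - v\<bar>" for u v :: real
      by arith
    then show ?thesis unfolding tent_def .
  qed
  also have "\<dots> = 2 * \<bar>infnorm (x - c) - infnorm (y - c)\<bar> / s"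
  proof -
    have "2 * u / s - 2 * v / s = (2 / s) * (u - v)" for u v
      by (simp add: right_diff_distrib diff_divide_distrib)
    then show ?thesis
      using assms by (simp only: abs_mult) simp
  qed
  also have "\<dots> \<le> 2 * infnorm (x - y) / s"
    using assms absdiff_infnorm[of "x - c" "y - c"] by (simp add: divide_right_mono)
  finally show ?thesis .
qed

lemma continuous_on_tent: "continuous_on S (tent c s)"
  unfolding tent_def[abs_def] divide_inverse by (intro continuous_intros)

lemma borel_measurable_tent: "tent c s \<in> borel_measurable lebesgue"
  by (intro locally_integrable_borel_measurable continuous_imp_locally_integrable continuous_on_tent)

lemma nn_integral_tent_le:
  fixes c :: "real^'n"
  assumes "0 < s"
  shows "(\<integral>\<^sup>+x. ennreal (tent c s x) \<partial>lebesgue) \<le> ennreal (2 * 2 ^ CARD('n) * s ^ CARD('n))"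
proof -
  have "(\<integral>\<^sup>+x. ennreal (tent c s x) \<partial>lebesgue) \<le> (\<integral>\<^sup>+x. 2 * indicator (cube c (2 * s)) x \<partial>lebesgue)"
  proof (intro nn_integral_mono)
    fix x
    have "ennreal (tent c s x) \<le> ennreal 2"
      using tent_le_2[OF assms] by (rule ennreal_leI)
    then show "ennreal (tent c s x) \<le> 2 * indicator (cube c (2 * s)) x"
      using tent_eq_0[OF assms, of x c] by (auto simp: indicator_def)
  qed
  also have "\<dots> = 2 * emeasure lebesgue (cube c (2 * s))"
    by (rule nn_integral_cmult_indicator) simp
  also have "\<dots> = ennreal (2 * 2 ^ CARD('n) * s ^ CARD('n))"
    using assms by (simp add: emeasure_lebesgue_cube power_mult_distrib ennreal_mult mult.assoc del: emeasure_completion)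
  finally show ?thesis .
qed

context dyadic_grid
begin

text \<open>The Carleson packing condition, for finite families.  Cells are recorded as pairs of generation and
index.\<close>

definition packed :: "real \<Rightarrow> (nat \<times> (int^'n)) set \<Rightarrow> bool" where
  "packed K F \<longleftrightarrow> finite F \<and>
     (\<forall>k m. (\<Sum>P\<in>{P\<in>F. k \<le> fst P \<and> anc (fst P) k (snd P) = m}. side (fst P) ^ CARD('n))
        \<le> K * side k ^ CARD('n))"

abbreviation cell_tent :: "nat \<times> (int^'n) \<Rightarrow> real^'n \<Rightarrow> real" where
  "cell_tent P \<equiv> tent (centre (fst P) (snd P)) (side (fst P))"

abbreviation tent_sum :: "(nat \<times> (int^'n)) set \<Rightarrow> real^'n \<Rightarrow> real" where
  "tent_sum F x \<equiv> \<Sum>P\<in>F. cell_tent P x"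

lemma packed_nonneg:
  assumes "packed K F"
  shows "0 \<le> K"
proof -
  have "0 \<le> (\<Sum>P\<in>{P\<in>F. 0 \<le> fst P \<and> anc (fst P) 0 (snd P) = 0}. side (fst P) ^ CARD('n))"
    by (intro sum_nonneg) simp
  also have "\<dots> \<le> K * side 0 ^ CARD('n)"
    using assms unfolding packed_def by blast
  finally show ?thesis
    using zero_less_power[OF L_pos, of "CARD('n)"] by (auto simp: zero_le_mult_iff)
qed

text \<open>The packing condition passes from dyadic cells to all cubes: group the small cells by
their ancestors of side comparable to \<open>l\<close>, which are disjoint and contained in a slightly larger cube.\<close>

lemma packed_sum_in_cube_le:
  assumes F: "packed K F" and l: "0 < l"
  shows "(\<Sum>P\<in>{P\<in>F. side (fst P) \<le> l \<and> cell (fst P) (snd P) \<subseteq> cube c (4 * l)}. side (fst P) ^ CARD('n))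
    \<le> K * (6 * l) ^ CARD('n)"
proof -
  let ?S = "{P\<in>F. side (fst P) \<le> l \<and> cell (fst P) (snd P) \<subseteq> cube c (4 * l)}"
  define k where "k = (LEAST k. side k \<le> l)"
  let ?g = "\<lambda>P. anc (fst P) k (snd P)"
  have side_k: "side k \<le> l"
    unfolding k_def using ex_side_le[OF l] by (rule LeastI_ex)
  have k_le: "k \<le> fst P" if "P \<in> ?S" for P
    unfolding k_def using that by (intro Least_le) simp
  have fin: "finite F" using F by (simp add: packed_def)
  then have finS: "finite ?S" by simp
  have K: "0 \<le> K"
    using F by (rule packed_nonneg)
  have sub: "cell k m \<subseteq> cube c (6 * l)" if m: "m \<in> ?g ` ?S" for m
  proof
    fix z assume z: "z \<in> cell k m"
    obtain P where P: "m = ?g P" "P \<in> ?S" using m by blast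
    obtain y where y: "y \<in> cell (fst P) (snd P)" using cell_nonempty by blast
    have "infnorm (z - y) \<le> l"
      using infnorm_diff_cell_le[OF z, of y] cell_subset_anc[OF k_le[OF P(2)], of "snd P"] y P(1) side_k
      by auto
    moreover have "infnorm (y - c) \<le> 4 * l / 2"
      using P(2) y by (auto simp: mem_cube_iff_infnorm)
    moreover have "infnorm (z - c) \<le> infnorm (z - y) + infnorm (y - c)"
      using infnorm_triangle[of "z - y" "y - c"] by simp
    ultimately show "z \<in> cube c (6 * l)"
      unfolding mem_cube_iff_infnorm by linarith
  qed
  have "(\<Sum>P\<in>?S. side (fst P) ^ CARD('n))
    = (\<Sum>m\<in>?g ` ?S. \<Sum>P\<in>{P\<in>?S. ?g P = m}. side (fst P) ^ CARD('n))"
    using finS by (intro sum.group[symmetric]) auto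
  also have "\<dots> \<le> (\<Sum>m\<in>?g ` ?S. K * side k ^ CARD('n))"
  proof (intro sum_mono)
    fix m
    have "(\<Sum>P\<in>{P\<in>?S. ?g P = m}. side (fst P) ^ CARD('n))
      \<le> (\<Sum>P\<in>{P\<in>F. k \<le> fst P \<and> anc (fst P) k (snd P) = m}. side (fst P) ^ CARD('n))"
      using fin k_le by (intro sum_mono2) auto
    also have "\<dots> \<le> K * side k ^ CARD('n)"
      using F by (simp add: packed_def)
    finally show "(\<Sum>P\<in>{P\<in>?S. ?g P = m}. side (fst P) ^ CARD('n)) \<le> K * side k ^ CARD('n)" .
  qed
  also have "\<dots> = K * (real (card (?g ` ?S)) * side k ^ CARD('n))"
    by simp
  also have "\<dots> \<le> K * (6 * l) ^ CARD('n)"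
    using finS sub l K by (intro mult_left_mono sum_volume_cells_le) auto
  finally show ?thesis .
qed

lemma cell_subset_cube_of_near:
  assumes "z \<in> cube (centre k m) (2 * side k)" "z \<in> cube c l" "side k \<le> r" "l \<le> r"
  shows "cell k m \<subseteq> cube c (4 * r)"
proof
  fix y assume "y \<in> cell k m"
  then have "infnorm (y - centre k m) \<le> side k / 2"
    by (rule infnorm_le_of_mem_cell)
  moreover have "infnorm (centre k m - z) \<le> side k" "infnorm (z - c) \<le> l / 2"
    using assms(1,2) infnorm_sub[of "centre k m" z] by (simp_all add: mem_cube_iff_infnorm)
  moreover have "infnorm (y - c) \<le> infnorm (y - centre k m) + (infnorm (centre k m - z) + infnorm (z - c))"
    using infnorm_triangle[of "y - centre k m" "centre k m - c"]
      infnorm_triangle[of "centre k m - z" "z - c"] by simp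
  ultimately have "infnorm (y - c) \<le> 2 * r"
    using assms(3,4) by linarith
  then show "y \<in> cube c (4 * r)"
    by (simp add: mem_cube_iff_infnorm)
qed

text \<open>At each generation at most \<open>4^n\<close> tents wider than the cube meet it, and each varies on it by at most
the ratio of the two sides; the ratios form a geometric series.\<close>

lemma large_tents_variation_le:
  assumes fin: "finite F" and l: "0 < l" and x: "x \<in> cube c l"
  shows "(\<Sum>P\<in>{P\<in>F. l < side (fst P)}. \<bar>cell_tent P x - cell_tent P c\<bar>) \<le> 2 * 4 ^ CARD('n)"
proof -
  define k where "k = (LEAST k. side k \<le> l)"
  have side_k: "side k \<le> l"
    unfolding k_def using ex_side_le[OF l] by (rule LeastI_ex)
  have lt_k: "j < k" if "l < side j" for j
    using that side_k side_antimono[of k j] by (cases "k \<le> j") auto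
  have c: "c \<in> cube c l"
    using l by (simp add: mem_cube_iff_infnorm infnorm_0)
  let ?Big = "{P\<in>F. l < side (fst P)}"
  let ?N = "{P\<in>?Big. cell (fst P) (snd P) \<subseteq> cube c (4 * side (fst P))}"
  have "(\<Sum>P\<in>?Big. \<bar>cell_tent P x - cell_tent P c\<bar>) = (\<Sum>P\<in>?N. \<bar>cell_tent P x - cell_tent P c\<bar>)"
  proof (rule sum.mono_neutral_right)
    show "\<forall>P\<in>?Big - ?N. \<bar>cell_tent P x - cell_tent P c\<bar> = 0"
    proof
      fix P assume P: "P \<in> ?Big - ?N"
      then have "x \<notin> cube (centre (fst P) (snd P)) (2 * side (fst P))"
        "c \<notin> cube (centre (fst P) (snd P)) (2 * side (fst P))"
        using cell_subset_cube_of_near[OF _ x, of "fst P" "snd P" "side (fst P)"]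
          cell_subset_cube_of_near[OF _ c, of "fst P" "snd P" "side (fst P)"] by auto
      then show "\<bar>cell_tent P x - cell_tent P c\<bar> = 0"
        by (simp add: tent_eq_0)
    qed
  qed (use fin in auto)
  also have "\<dots> \<le> (\<Sum>P\<in>?N. l / side (fst P))"
  proof (intro sum_mono)
    fix P
    have "\<bar>cell_tent P x - cell_tent P c\<bar> \<le> 2 * infnorm (x - c) / side (fst P)"
      by (rule tent_Lipschitz) simp
    also have "\<dots> \<le> l / side (fst P)"
      using x by (intro divide_right_mono) (auto simp: mem_cube_iff_infnorm)
    finally show "\<bar>cell_tent P x - cell_tent P c\<bar> \<le> l / side (fst P)" .
  qed
  also have "\<dots> = (\<Sum>j<k. \<Sum>P\<in>{P\<in>?N. fst P = j}. l / side (fst P))"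
    using fin lt_k by (intro sum.group[symmetric]) auto
  also have "\<dots> \<le> (\<Sum>j<k. 4 ^ CARD('n) * (l / side j))"
  proof (intro sum_mono)
    fix j
    let ?J = "{P\<in>?N. fst P = j}"
    have "real (card (snd ` ?J)) * side j ^ CARD('n) \<le> (4 * side j) ^ CARD('n)"
      using fin by (intro sum_volume_cells_le[of _ j c]) auto
    then have "real (card (snd ` ?J)) \<le> 4 ^ CARD('n)"
      by (simp add: power_mult_distrib)
    moreover have "card (snd ` ?J) = card ?J"
      by (intro card_image inj_onI) (auto simp: prod_eq_iff)
    moreover have "(\<Sum>P\<in>?J. l / side (fst P)) = (\<Sum>P\<in>?J. l / side j)"
      by (intro sum.cong) auto
    ultimately show "(\<Sum>P\<in>?J. l / side (fst P)) \<le> 4 ^ CARD('n) * (l / side j)"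
      using l by (simp only: sum_constant) (intro mult_right_mono, auto)
  qed
  also have "\<dots> = 4 ^ CARD('n) * (\<Sum>j<k. l / side j)"
    by (simp add: sum_distrib_left)
  also have "(\<Sum>j<k. l / side j) \<le> 2"
  proof (cases k)
    case 0
    then show ?thesis by simp
  next
    case (Suc k')
    have "\<not> side k' \<le> l"
      using Suc not_less_Least[of k' "\<lambda>k. side k \<le> l"] unfolding k_def[symmetric] by simp
    then have "l * 2 ^ k' < L"
      by (simp add: side_def pos_divide_le_eq not_le pos_less_divide_eq)
    moreover have "(\<Sum>j<k. l / side j) = l / L * (2 ^ k - 1)"
      by (simp add: side_def sum_divide_distrib[symmetric] sum_distrib_left[symmetric]
          mask_eq_sum_exp geometric_sum[of "2::real" k, simplified])
    moreover have "l / L * (2 ^ k - 1) \<le> l / L * 2 ^ k"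
      using l L_pos by (intro mult_left_mono) auto
    ultimately show ?thesis
      using L_pos Suc by (simp add: pos_divide_le_eq)
  qed
  finally show ?thesis by simp
qed

lemma locally_integrable_tent_sum: "locally_integrable (tent_sum F)"
  by (intro continuous_imp_locally_integrable continuous_on_sum continuous_on_tent)

text \<open>On a cube of side \<open>l\<close> the tents over cells of side at most \<open>l\<close> have a small integral by packing, and the
sum of the wider ones is almost constant.\<close>

lemma bmo_norm_tent_sum_le:
  assumes F: "packed K F"
  shows "bmo_norm (tent_sum F) \<le> ennreal (2 * (2 * 12 ^ CARD('n) * K + 2 * 4 ^ CARD('n)))"
proof (rule bmo_norm_leI[OF locally_integrable_tent_sum])
  have fin: "finite F" using F by (simp add: packed_def)
  have K: "0 \<le> K"
    using F by (rule packed_nonneg)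
  then show "0 \<le> 2 * 12 ^ CARD('n) * K + 2 * 4 ^ CARD('n)" by simp
  fix c :: "real^'n" and l :: real assume l: "0 < l"
  let ?Big = "{P\<in>F. l < side (fst P)}"
  let ?S = "{P\<in>F. side (fst P) \<le> l \<and> cell (fst P) (snd P) \<subseteq> cube c (4 * l)}"
  let ?b = "\<Sum>P\<in>?Big. cell_tent P c"
  have pointwise: "\<bar>tent_sum F x - ?b\<bar> \<le> (\<Sum>P\<in>?S. cell_tent P x) + 2 * 4 ^ CARD('n)" if x: "x \<in> cube c l" for x
  proof -
    have "tent_sum F x = (\<Sum>P\<in>?Big. cell_tent P x) + (\<Sum>P\<in>F - ?Big. cell_tent P x)"
      using fin by (subst sum.subset_diff[of ?Big]) auto
    also have "(\<Sum>P\<in>F - ?Big. cell_tent P x) = (\<Sum>P\<in>?S. cell_tent P x)"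
    proof (rule sum.mono_neutral_right)
      show "\<forall>P\<in>F - ?Big - ?S. cell_tent P x = 0"
      proof
        fix P assume P: "P \<in> F - ?Big - ?S"
        then have "x \<notin> cube (centre (fst P) (snd P)) (2 * side (fst P))"
          using cell_subset_cube_of_near[OF _ x, of "fst P" "snd P" l] by auto
        then show "cell_tent P x = 0" by (simp add: tent_eq_0)
      qed
    qed (use fin in auto)
    finally have "tent_sum F x - ?b = (\<Sum>P\<in>?Big. cell_tent P x - cell_tent P c) + (\<Sum>P\<in>?S. cell_tent P x)"
      by (simp add: sum_subtractf)
    then have "\<bar>tent_sum F x - ?b\<bar> = \<bar>(\<Sum>P\<in>?Big. cell_tent P x - cell_tent P c) + (\<Sum>P\<in>?S. cell_tent P x)\<bar>"
      by (rule arg_cong)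
    also have "\<dots> \<le> (\<Sum>P\<in>?Big. \<bar>cell_tent P x - cell_tent P c\<bar>) + (\<Sum>P\<in>?S. cell_tent P x)"
      by (intro order_trans[OF abs_triangle_ineq] add_mono sum_abs) (simp add: sum_nonneg)
    finally show ?thesis
      using large_tents_variation_le[OF fin l x] by linarith
  qed
  have "(\<integral>\<^sup>+x\<in>cube c l. ennreal \<bar>tent_sum F x - ?b\<bar> \<partial>lebesgue)
    \<le> (\<integral>\<^sup>+x. (\<Sum>P\<in>?S. ennreal (cell_tent P x)) + ennreal (2 * 4 ^ CARD('n)) * indicator (cube c l) x \<partial>lebesgue)"
  proof (intro nn_integral_mono)
    fix x
    show "ennreal \<bar>tent_sum F x - ?b\<bar> * indicator (cube c l) x
      \<le> (\<Sum>P\<in>?S. ennreal (cell_tent P x)) + ennreal (2 * 4 ^ CARD('n)) * indicator (cube c l) x"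
    proof (cases "x \<in> cube c l")
      case True
      have "ennreal \<bar>tent_sum F x - ?b\<bar> \<le> ennreal ((\<Sum>P\<in>?S. cell_tent P x) + 2 * 4 ^ CARD('n))"
        by (intro ennreal_leI pointwise True)
      also have "\<dots> = (\<Sum>P\<in>?S. ennreal (cell_tent P x)) + ennreal (2 * 4 ^ CARD('n))"
        by (simp add: sum_nonneg)
      finally show ?thesis using True by simp
    qed simp
  qed
  also have "\<dots> = (\<Sum>P\<in>?S. \<integral>\<^sup>+x. ennreal (cell_tent P x) \<partial>lebesgue)
      + ennreal (2 * 4 ^ CARD('n)) * emeasure lebesgue (cube c l)"
  proof -
    note [measurable] = borel_measurable_tent
    show ?thesis
      by (simp add: nn_integral_add nn_integral_sum nn_integral_cmult_indicator
          del: sum_ennreal emeasure_completion)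
  qed
  also have "\<dots> \<le> (\<Sum>P\<in>?S. ennreal (2 * 2 ^ CARD('n) * side (fst P) ^ CARD('n)))
      + ennreal (2 * 4 ^ CARD('n)) * ennreal (l ^ CARD('n))"
    using l by (intro add_mono sum_mono nn_integral_tent_le)
      (auto simp: emeasure_lebesgue_cube simp del: emeasure_completion)
  also have "\<dots> = ennreal (2 * 2 ^ CARD('n) * (\<Sum>P\<in>?S. side (fst P) ^ CARD('n)) + 2 * 4 ^ CARD('n) * l ^ CARD('n))"
    using l by (simp add: ennreal_mult[symmetric] sum_distrib_left sum_nonneg)
  also have "\<dots> \<le> ennreal (2 * 2 ^ CARD('n) * (K * (6 * l) ^ CARD('n)) + 2 * 4 ^ CARD('n) * l ^ CARD('n))"
    by (intro ennreal_leI add_mono mult_left_mono packed_sum_in_cube_le F l) auto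
  also have "2 * 2 ^ CARD('n) * (K * (6 * l) ^ CARD('n)) + 2 * 4 ^ CARD('n) * l ^ CARD('n)
     = (2 * 12 ^ CARD('n) * K + 2 * 4 ^ CARD('n)) * l ^ CARD('n)"
  proof -
    have "(2::real) ^ CARD('n) * 6 ^ CARD('n) = 12 ^ CARD('n)"
      by (simp add: power_mult_distrib[symmetric])
    then show ?thesis by (simp add: power_mult_distrib algebra_simps)
  qed
  finally show "\<exists>b. (\<integral>\<^sup>+x\<in>cube c l. ennreal \<bar>tent_sum F x - b\<bar> \<partial>lebesgue)
    \<le> ennreal ((2 * 12 ^ CARD('n) * K + 2 * 4 ^ CARD('n)) * l ^ CARD('n))" by blast
qed

end

section \<open>Stopping cells\<close>

context dyadic_grid
begin

text \<open>The average of \<open>w\<close>, computed from the mass of the cell, which is additive over children.\<close>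

definition mean :: "(real^'n \<Rightarrow> real) \<Rightarrow> nat \<Rightarrow> int^'n \<Rightarrow> real" where
  "mean w k m = enn2real (wmeas w (cell k m)) / side k ^ CARD('n)"

lemma mean_nonneg [simp]: "0 \<le> mean w k m"
  by (simp add: mean_def)

lemma wmeas_cell_eq_mean:
  assumes "weight w"
  shows "wmeas w (cell k m) = ennreal (mean w k m * side k ^ CARD('n))"
  using wmeas_cell_finite[OF assms, of k m] by (simp add: mean_def)

lemma wmeas_cell_children:
  assumes "weight w"
  shows "wmeas w (cell k m) = (\<Sum>m'\<in>children m. wmeas w (cell (Suc k) m'))"
  unfolding wmeas_def using weight_borel_measurable[OF assms]
  by (intro nn_integral_cell_children) measurable

lemma mean_children:
  assumes "weight w"
  shows "mean w k m * side k ^ CARD('n) = (\<Sum>m'\<in>children m. mean w (Suc k) m' * side (Suc k) ^ CARD('n))"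
proof -
  have "ennreal (mean w k m * side k ^ CARD('n))
    = ennreal (\<Sum>m'\<in>children m. mean w (Suc k) m' * side (Suc k) ^ CARD('n))"
    using wmeas_cell_children[OF assms, of k m] by (simp add: wmeas_cell_eq_mean[OF assms])
  then show ?thesis
    by (subst (asm) ennreal_inj) (auto intro: sum_nonneg)
qed

text \<open>The average of \<open>w\<close> over the last selected cell among the ancestors of a cell, itself included; a cell is
selected when its average exceeds twice the level of its parent.\<close>

primrec stop_level :: "(real^'n \<Rightarrow> real) \<Rightarrow> nat \<Rightarrow> int^'n \<Rightarrow> real" where
  "stop_level w 0 m = mean w 0 m"
| "stop_level w (Suc k) m =
    (if 2 * stop_level w k (anc (Suc k) k m) < mean w (Suc k) m then mean w (Suc k) m
     else stop_level w k (anc (Suc k) k m))"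

text \<open>The selected cells of generation at most \<open>N\<close> inside cell \<open>0\<close> of generation \<open>0\<close>.\<close>

definition stops :: "(real^'n \<Rightarrow> real) \<Rightarrow> nat \<Rightarrow> (nat \<times> (int^'n)) set" where
  "stops w N = {(k, m). k \<le> N \<and> anc k 0 m = 0
     \<and> (k = 0 \<or> 2 * stop_level w (k - 1) (anc k (k - 1) m) < mean w k m)}"

lemma mean_le_stop_level: "mean w k m \<le> 2 * stop_level w k m"
  by (cases k) auto

lemma stop_level_attained:
  assumes "anc k 0 m = 0"
  shows "\<exists>j\<le>k. (j, anc k j m) \<in> stops w k \<and> stop_level w k m = mean w j (anc k j m)"
  using assms
proof (induction k arbitrary: m)
  case 0
  then show ?case by (auto simp: stops_def)
next
  case (Suc k)
  show ?case
  proof (cases "2 * stop_level w k (anc (Suc k) k m) < mean w (Suc k) m")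
    case True
    then show ?thesis
      using Suc.prems by (intro exI[of _ "Suc k"]) (auto simp: stops_def)
  next
    case False
    have "anc k 0 (anc (Suc k) k m) = 0"
      using Suc.prems by (simp add: anc_anc)
    from Suc.IH[OF this] obtain j where j: "j \<le> k" "(j, anc k j (anc (Suc k) k m)) \<in> stops w k"
      "stop_level w k (anc (Suc k) k m) = mean w j (anc k j (anc (Suc k) k m))" by blast
    moreover have "anc k j (anc (Suc k) k m) = anc (Suc k) j m"
      using j(1) by (simp add: anc_anc)
    ultimately show ?thesis
      using False by (intro exI[of _ j]) (auto simp: stops_def)
  qed
qed

lemma finite_stops: "finite (stops w N)"
proof (rule finite_subset)
  show "stops w N \<subseteq> (SIGMA k:{..N}. {m. cell k m \<subseteq> closed_cell 0 0})"
  proof (clarsimp simp: stops_def)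
    fix k m x assume *: "anc k 0 m = 0" "x \<in> cell k m"
    then have "x \<in> cell 0 0"
      using cell_subset_anc[of 0 k m] by auto
    then have "x \<in> closed_cell 0 0"
      by (rule subsetD[OF cell_subset_closed_cell])
    then show "x \<in> cube (centre 0 0) L" by simp
  qed
  show "finite (SIGMA k:{..N}. {m. cell k m \<subseteq> closed_cell 0 0})"
    by (intro finite_SigmaI finite_cells_in_cube) simp
qed

lemma cell_stop_subset: "P \<in> stops w N \<Longrightarrow> cell (fst P) (snd P) \<subseteq> cell 0 0"
  using cell_subset_anc[of 0 "fst P" "snd P"] by (auto simp: stops_def)

lemma stop_level_pos:
  assumes "0 < mean w 0 0" "anc k 0 m = 0"
  shows "0 < stop_level w k m"
  using assms(2)
proof (induction k arbitrary: m)
  case 0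
  then show ?case using assms(1) by simp
next
  case (Suc k)
  have "anc k 0 (anc (Suc k) k m) = 0"
    using Suc.prems by (simp add: anc_anc)
  from Suc.IH[OF this] show ?case by auto
qed

text \<open>The volume \<open>T\<close> of the selected cells strictly below \<open>P\<close> is at most \<open>w(P) / \<theta>\<close>, where \<open>\<theta>\<close> is the level of \<open>P\<close>
(\<open>T_bound\<close>), and \<open>w\<^sub>P \<le> 2 \<theta>\<close>.  The bound for \<open>T\<close> goes by induction from small to large cells: a selected
child \<open>P'\<close> has level \<open>w\<^bsub>P'\<^esub> > 2 \<theta>\<close>, so that it and the selected cells below it have volume at most
\<open>2 \<bar>P'\<bar> \<le> w(P') / \<theta>\<close>.\<close>

lemma packed_stops:
  assumes w: "weight w" and pos: "0 < mean w 0 0"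
  shows "packed 3 (stops w N)"
proof -
  let ?n = "CARD('n)"
  let ?F = "stops w N"
  define U where "U k m = (\<Sum>P\<in>{P\<in>?F. k \<le> fst P \<and> anc (fst P) k (snd P) = m}. side (fst P) ^ ?n)" for k m
  define T where "T k m = (\<Sum>m'\<in>children m. U (Suc k) m')" for k m
  have U_eq: "U k m = (if (k, m) \<in> ?F then side k ^ ?n else 0) + T k m" for k m
  proof -
    let ?A = "{P\<in>?F. Suc k \<le> fst P \<and> anc (fst P) k (snd P) = m}"
    have "{P\<in>?F. k \<le> fst P \<and> anc (fst P) k (snd P) = m} = {P\<in>?F. P = (k, m)} \<union> ?A"
      by (auto simp: prod_eq_iff not_less_eq_eq le_Suc_eq dest: le_antisym)
    then have "U k m = (\<Sum>P\<in>{P\<in>?F. P = (k, m)}. side (fst P) ^ ?n) + (\<Sum>P\<in>?A. side (fst P) ^ ?n)"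
      unfolding U_def using finite_stops[of w N] by (simp add: sum.union_disjoint disjoint_iff)
    moreover have "(\<Sum>P\<in>{P\<in>?F. P = (k, m)}. side (fst P) ^ ?n) = (if (k, m) \<in> ?F then side k ^ ?n else 0)"
    proof -
      have "{P\<in>?F. P = (k, m)} = (if (k, m) \<in> ?F then {(k, m)} else {})" by auto
      then show ?thesis by simp
    qed
    moreover have "(\<Sum>P\<in>?A. side (fst P) ^ ?n) = T k m"
    proof -
      have child: "anc (fst P) k (snd P) = m \<longleftrightarrow> anc (fst P) (Suc k) (snd P) \<in> children m" if "Suc k \<le> fst P" for P
        using that by (simp add: children_iff_anc[of _ _ k] anc_anc)
      have "(\<Sum>P\<in>?A. side (fst P) ^ ?n)
        = (\<Sum>m'\<in>children m. \<Sum>P\<in>{P\<in>?A. anc (fst P) (Suc k) (snd P) = m'}. side (fst P) ^ ?n)"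
        using finite_stops[of w N] child by (intro sum.group[symmetric]) auto
      also have "\<dots> = T k m"
        unfolding T_def U_def using child by (intro sum.cong refl) auto
      finally show ?thesis .
    qed
    ultimately show ?thesis by simp
  qed
  have T_bound: "stop_level w k m * T k m \<le> mean w k m * side k ^ ?n"
    if "anc k 0 m = 0" "N \<le> k + d" for d k m
    using that
  proof (induction d arbitrary: k m)
    case 0
    have "U (Suc k) m' = 0" for m'
      unfolding U_def using 0 by (intro sum.neutral) (auto simp: stops_def)
    then show ?case by (simp add: T_def)
  next
    case (Suc d)
    let ?\<theta> = "stop_level w k m" and ?V = "side (Suc k) ^ ?n"
    have child: "?\<theta> * U (Suc k) m' \<le> mean w (Suc k) m' * ?V" if m': "m' \<in> children m" for m'
    proof -
      have anc_m': "anc (Suc k) k m' = m"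
        using m' by (simp add: children_iff_anc[of _ _ k])
      then have anc0: "anc (Suc k) 0 m' = 0"
        using Suc.prems(1) anc_anc[of 0 k "Suc k" m'] by simp
      have IH: "stop_level w (Suc k) m' * T (Suc k) m' \<le> mean w (Suc k) m' * ?V"
        using Suc.prems(2) anc0 by (intro Suc.IH) auto
      have V: "0 < ?V" by simp
      show ?thesis
      proof (cases "2 * ?\<theta> < mean w (Suc k) m'")
        case True
        have \<theta>: "0 < ?\<theta>"
          by (rule stop_level_pos[OF pos Suc.prems(1)])
        have "mean w (Suc k) m' * T (Suc k) m' \<le> mean w (Suc k) m' * ?V"
          using IH True anc_m' by simp
        then have "T (Suc k) m' \<le> ?V"
          using True \<theta> by (simp add: mult_le_cancel_left)
        moreover have "U (Suc k) m' \<le> ?V + T (Suc k) m'"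
          unfolding U_eq[of "Suc k"] using V by simp
        ultimately have "U (Suc k) m' \<le> 2 * ?V" by linarith
        then have "?\<theta> * U (Suc k) m' \<le> ?\<theta> * (2 * ?V)"
          using \<theta> by (intro mult_left_mono) auto
        also have "\<dots> = (2 * ?\<theta>) * ?V" by simp
        also have "\<dots> \<le> mean w (Suc k) m' * ?V"
          using True V by (intro mult_right_mono) auto
        finally show ?thesis .
      next
        case False
        then have "(Suc k, m') \<notin> ?F"
          using anc_m' by (simp add: stops_def)
        then show ?thesis
          using IH False anc_m' by (simp add: U_eq[of "Suc k"])
      qed
    qed
    have "?\<theta> * T k m = (\<Sum>m'\<in>children m. ?\<theta> * U (Suc k) m')"
      by (simp add: T_def sum_distrib_left)
    also have "\<dots> \<le> (\<Sum>m'\<in>children m. mean w (Suc k) m' * ?V)"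
      by (intro sum_mono child)
    also have "\<dots> = mean w k m * side k ^ ?n"
      by (rule mean_children[OF w, symmetric])
    finally show ?case .
  qed
  have "U k m \<le> 3 * side k ^ ?n" for k m
  proof (cases "anc k 0 m = 0")
    case True
    have \<theta>: "0 < stop_level w k m"
      by (rule stop_level_pos[OF pos True])
    have "stop_level w k m * T k m \<le> mean w k m * side k ^ ?n"
      by (rule T_bound[OF True, of N]) simp
    also have "\<dots> \<le> (2 * stop_level w k m) * side k ^ ?n"
      by (intro mult_right_mono mean_le_stop_level) simp
    finally have "T k m \<le> 2 * side k ^ ?n"
      using \<theta> by (simp add: mult.assoc mult.left_commute[of 2])
    moreover have "U k m \<le> side k ^ ?n + T k m"
      by (simp add: U_eq[of k])
    ultimately show ?thesis by linarith
  next
    case False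
    have "{P\<in>?F. k \<le> fst P \<and> anc (fst P) k (snd P) = m} = {}"
      using False anc_anc[of 0 k] by (auto simp: stops_def)
    then have "U k m = 0"
      unfolding U_def by (simp only: sum.empty)
    then show ?thesis by simp
  qed
  then show ?thesis
    by (simp add: packed_def finite_stops U_def)
qed

section \<open>Domination of the maximal function\<close>

definition stop_sum :: "(real^'n \<Rightarrow> real) \<Rightarrow> nat \<Rightarrow> real^'n \<Rightarrow> real" where
  "stop_sum w N x = (\<Sum>P\<in>stops w N. mean w (fst P) (snd P)
     * indicator (cube (centre (fst P) (snd P)) (3 * side (fst P))) x)"

lemma stop_sum_nonneg: "0 \<le> stop_sum w N x"
  unfolding stop_sum_def by (intro sum_nonneg) auto

lemma stop_sum_mono: "M \<le> N \<Longrightarrow> stop_sum w M x \<le> stop_sum w N x"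
  unfolding stop_sum_def using finite_stops[of w N]
  by (intro sum_mono2) (auto simp: stops_def)

lemma mean_le_stop_sum:
  assumes "(j, m) \<in> stops w N" "x \<in> cube (centre j m) (3 * side j)"
  shows "mean w j m \<le> stop_sum w N x"
proof -
  have "mean w j m = (\<Sum>P\<in>{(j, m)}. mean w (fst P) (snd P)
     * indicator (cube (centre (fst P) (snd P)) (3 * side (fst P))) x)"
    using assms(2) by simp
  also have "\<dots> \<le> stop_sum w N x"
    unfolding stop_sum_def using assms(1) finite_stops[of w N] by (intro sum_mono2) auto
  finally show ?thesis .
qed

text \<open>Cover the part of the cube inside \<open>Q\<close> by at most \<open>3^n\<close> dyadic cells of comparable side.  The average over each of
them is at most twice that over the last selected ancestor \<open>P\<close>, and \<open>P\<close> is so large that \<open>x\<close> belongs to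
\<open>3P\<close>.  Cubes larger than \<open>Q\<close> are handled by \<open>Q\<close> itself, which is selected.\<close>

lemma cube_mean_le_stop_sum:
  fixes c x :: "real^'n"
  assumes w: "weight w" and x: "x \<in> cube c r" "x \<in> closed_cell 0 0" and r: "0 < r"
  shows "\<exists>N. (\<integral>\<^sup>+y\<in>cube c r. ennreal \<bar>w y * indicator (closed_cell 0 0) y\<bar> \<partial>lebesgue)
      \<le> ennreal (2 * 6 ^ CARD('n) * stop_sum w N x * r ^ CARD('n))"
proof -
  let ?n = "CARD('n)"
  let ?I = "\<integral>\<^sup>+y\<in>cube c r. ennreal \<bar>w y * indicator (closed_cell 0 0) y\<bar> \<partial>lebesgue"
  have I_eq: "?I = wmeas w (cell 0 0 \<inter> cube c r)"
    unfolding wmeas_def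
    by (rule nn_integral_cong_AE)
      (use AE_closed_cell_iff[of 0 0] in \<open>auto simp: indicator_def weight_nonneg[OF w]\<close>)
  show ?thesis
  proof (cases "L \<le> r")
    case True
    have "(0, 0) \<in> stops w 0"
      by (simp add: stops_def)
    moreover have "x \<in> cube (centre 0 0) (3 * side 0)"
      using x(2) L_pos by (simp add: mem_cube_iff_infnorm)
    ultimately have mean: "mean w 0 0 \<le> stop_sum w 0 x"
      by (rule mean_le_stop_sum)
    have "?I \<le> wmeas w (cell 0 0)"
      unfolding I_eq by (rule wmeas_mono) auto
    also have "\<dots> = ennreal (mean w 0 0 * side 0 ^ ?n)"
      by (rule wmeas_cell_eq_mean[OF w])
    also have "\<dots> \<le> ennreal (2 * 6 ^ ?n * stop_sum w 0 x * r ^ ?n)"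
    proof (intro ennreal_leI mult_mono)
      have "1 * stop_sum w 0 x \<le> 2 * 6 ^ ?n * stop_sum w 0 x"
        using stop_sum_nonneg[of w 0 x] one_le_power[of "6::real" ?n]
        by (intro mult_right_mono) linarith+
      then show "mean w 0 0 \<le> 2 * 6 ^ ?n * stop_sum w 0 x"
        using mean by linarith
      show "side 0 ^ ?n \<le> r ^ ?n"
        using True L_pos by (intro power_mono) auto
    qed (use stop_sum_nonneg[of w 0 x] L_pos in auto)
    finally show ?thesis ..
  next
    case False
    \<comment> \<open>\<open>k\<close> below is the last generation whose side still exceeds \<open>r\<close>\<close>
    define k' where "k' = (LEAST k. side k \<le> r)"
    have side_k': "side k' \<le> r"
      unfolding k'_def using ex_side_le[OF r] by (rule LeastI_ex)
    have "k' \<noteq> 0"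
      using side_k' False by (cases k') auto
    then obtain k where k: "k' = Suc k"
      by (cases k') auto
    have r_less: "r < side k"
      using k not_less_Least[of k "\<lambda>k. side k \<le> r"] unfolding k'_def[symmetric] by simp
    have side_le: "side k \<le> 2 * r"
      using side_k' k by (simp add: side_Suc)
    let ?J = "{m. cell k m \<inter> cube c r \<noteq> {} \<and> anc k 0 m = 0}"
    have sub: "cell k m \<subseteq> cube c (3 * side k)" if m: "m \<in> ?J" for m
    proof
      fix y assume y: "y \<in> cell k m"
      obtain z where z: "z \<in> cell k m" "z \<in> cube c r"
        using m by auto
      have "infnorm (y - c) \<le> infnorm (y - z) + infnorm (z - c)"
        using infnorm_triangle[of "y - z" "z - c"] by simp
      then show "y \<in> cube c (3 * side k)"
        using infnorm_diff_cell_le[OF y z(1)] z(2) r_less by (simp add: mem_cube_iff_infnorm)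
    qed
    have fin: "finite ?J"
      by (rule finite_subset[OF _ finite_cells_in_cube[of k c "3 * side k"]]) (use sub in blast)
    have "real (card ?J) * side k ^ ?n \<le> (3 * side k) ^ ?n"
      using fin sub by (intro sum_volume_cells_le) auto
    then have card_J: "real (card ?J) \<le> 3 ^ ?n"
      by (simp add: power_mult_distrib)
    have mean_J: "mean w k m \<le> 2 * stop_sum w k x" if m: "m \<in> ?J" for m
    proof -
      obtain j where j: "j \<le> k" "(j, anc k j m) \<in> stops w k" "stop_level w k m = mean w j (anc k j m)"
        using stop_level_attained[of k m w] m by auto
      obtain z where z: "z \<in> cell k m" "z \<in> cube c r"
        using m by auto
      have "z \<in> cell j (anc k j m)"
        using cell_subset_anc[OF j(1)] z(1) by auto
      then have "infnorm (z - centre j (anc k j m)) \<le> side j / 2"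
        by (rule infnorm_le_of_mem_cell)
      moreover have "infnorm (x - z) \<le> infnorm (x - c) + infnorm (c - z)"
        using infnorm_triangle[of "x - c" "c - z"] by simp
      moreover have "infnorm (x - c) \<le> r / 2" "infnorm (c - z) \<le> r / 2"
        using x(1) z(2) infnorm_sub[of c z] by (simp_all add: mem_cube_iff_infnorm)
      moreover have "infnorm (x - centre j (anc k j m)) \<le> infnorm (x - z) + infnorm (z - centre j (anc k j m))"
        using infnorm_triangle[of "x - z" "z - centre j (anc k j m)"] by simp
      ultimately have "infnorm (x - centre j (anc k j m)) \<le> 3 * side j / 2"
        using r_less side_antimono[OF j(1)] by linarith
      then have "x \<in> cube (centre j (anc k j m)) (3 * side j)"
        unfolding mem_cube_iff_infnorm .
      then have "stop_level w k m \<le> stop_sum w k x"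
        unfolding j(3) by (rule mean_le_stop_sum[OF j(2)])
      then show ?thesis
        using mean_le_stop_level[of w k m] by linarith
    qed
    have "cell 0 0 \<inter> cube c r \<subseteq> (\<Union>m\<in>?J. cell k m)"
    proof
      fix y assume y: "y \<in> cell 0 0 \<inter> cube c r"
      then have "idx k y \<in> ?J"
        using idx_eq_anc[of 0 k y] mem_cell_idx[of y k]
        by (auto simp: mem_cell_iff_idx[of y 0] simp del: mem_cell_idx)
      then show "y \<in> (\<Union>m\<in>?J. cell k m)"
        using mem_cell_idx by blast
    qed
    then have "?I \<le> wmeas w (\<Union>m\<in>?J. cell k m)"
      unfolding I_eq by (rule wmeas_mono)
    also have "\<dots> = (\<Sum>m\<in>?J. wmeas w (cell k m))"
      unfolding wmeas_def using weight_borel_measurable[OF w] fin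
      by (intro nn_integral_finite_Union_disjoint disjoint_cells) (auto intro: measurable_compose)
    also have "\<dots> = ennreal (\<Sum>m\<in>?J. mean w k m * side k ^ ?n)"
      by (simp add: wmeas_cell_eq_mean[OF w])
    also have "\<dots> \<le> ennreal (\<Sum>m\<in>?J. 2 * stop_sum w k x * side k ^ ?n)"
      by (intro ennreal_leI sum_mono mult_right_mono mean_J) simp_all
    also have "(\<Sum>m\<in>?J. 2 * stop_sum w k x * side k ^ ?n) = real (card ?J) * (2 * stop_sum w k x * side k ^ ?n)"
      by (rule sum_constant)
    also have "ennreal \<dots> \<le> ennreal (3 ^ ?n * (2 * stop_sum w k x * (2 * r) ^ ?n))"
      using card_J side_le stop_sum_nonneg[of w k x]
      by (intro ennreal_leI mult_mono power_mono) auto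
    also have "3 ^ ?n * (2 * stop_sum w k x * (2 * r) ^ ?n) = 2 * 6 ^ ?n * stop_sum w k x * r ^ ?n"
    proof -
      have "(3::real) ^ ?n * 2 ^ ?n = 6 ^ ?n"
        by (simp add: power_mult_distrib[symmetric])
      then show ?thesis by (simp add: power_mult_distrib mult_ac)
    qed
    finally show ?thesis ..
  qed
qed

lemma maximal_op_le_stop_sum:
  assumes w: "weight w" and x: "x \<in> closed_cell 0 0"
  shows "maximal_op (\<lambda>y. w y * indicator (closed_cell 0 0) y) x
    \<le> (SUP N. ennreal (2 * 6 ^ CARD('n) * stop_sum w N x))"
  unfolding maximal_op_def
proof (rule SUP_least, clarify)
  fix c :: "real^'n" and r :: real assume r: "0 < r" "x \<in> cube c r"
  let ?I = "\<integral>\<^sup>+y\<in>cube c r. ennreal \<bar>w y * indicator (closed_cell 0 0) y\<bar> \<partial>lebesgue"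
  obtain N where N: "?I \<le> ennreal (2 * 6 ^ CARD('n) * stop_sum w N x * r ^ CARD('n))"
    using cube_mean_le_stop_sum[OF w r(2) x r(1)] by blast
  have "?I / emeasure lebesgue (cube c r) = ?I / ennreal (r ^ CARD('n))"
    by (simp only: emeasure_lebesgue_cube less_imp_le[OF r(1)])
  also have "\<dots> \<le> ennreal (2 * 6 ^ CARD('n) * stop_sum w N x)"
    using N r(1) stop_sum_nonneg[of w N x]
    by (subst ennreal_divide_le_iff) (auto simp: ennreal_mult[symmetric])
  also have "\<dots> \<le> (SUP N. ennreal (2 * 6 ^ CARD('n) * stop_sum w N x))"
    by (rule SUP_upper) simp
  finally show "?I / emeasure lebesgue (cube c r) \<le> (SUP N. ennreal (2 * 6 ^ CARD('n) * stop_sum w N x))" .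
qed

text \<open>The selected cells are exhausted by the finite families \<open>stops w N\<close>, so that later only finite sums of
tents are needed.\<close>

lemma integral_maximal_op_le:
  assumes w: "weight w"
  shows "(\<integral>\<^sup>+x\<in>closed_cell 0 0. maximal_op (\<lambda>y. w y * indicator (closed_cell 0 0) y) x \<partial>lebesgue)
    \<le> (SUP N. ennreal (2 * 18 ^ CARD('n)) * (\<Sum>P\<in>stops w N. wmeas w (cell (fst P) (snd P))))"
proof -
  let ?n = "CARD('n)"
  let ?h = "\<lambda>N x. ennreal (2 * 6 ^ ?n * stop_sum w N x)"
  have meas [measurable]: "stop_sum w N \<in> borel_measurable lebesgue" for N
    unfolding stop_sum_def[abs_def]
    by (intro borel_measurable_sum borel_measurable_times borel_measurable_const borel_measurable_indicator) simp
  have "(\<integral>\<^sup>+x\<in>closed_cell 0 0. maximal_op (\<lambda>y. w y * indicator (closed_cell 0 0) y) x \<partial>lebesgue)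
    \<le> (\<integral>\<^sup>+x. (SUP N. ?h N x) \<partial>lebesgue)"
  proof (intro nn_integral_mono)
    fix x
    show "maximal_op (\<lambda>y. w y * indicator (closed_cell 0 0) y) x * indicator (closed_cell 0 0) x \<le> (SUP N. ?h N x)"
      using maximal_op_le_stop_sum[OF w, of x] by (cases "x \<in> closed_cell 0 0") simp_all
  qed
  also have "\<dots> = (SUP N. \<integral>\<^sup>+x. ?h N x \<partial>lebesgue)"
    by (intro nn_integral_monotone_convergence_SUP)
       (auto simp: incseq_def le_fun_def intro!: ennreal_leI mult_left_mono stop_sum_mono)
  also have "\<dots> \<le> (SUP N. ennreal (2 * 18 ^ ?n) * (\<Sum>P\<in>stops w N. wmeas w (cell (fst P) (snd P))))"
  proof (intro SUP_mono bexI)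
    fix N
    have "(\<integral>\<^sup>+x. ?h N x \<partial>lebesgue) = (\<integral>\<^sup>+x. (\<Sum>P\<in>stops w N. ennreal (2 * 6 ^ ?n * mean w (fst P) (snd P))
       * indicator (cube (centre (fst P) (snd P)) (3 * side (fst P))) x) \<partial>lebesgue)"
    proof (intro nn_integral_cong)
      fix x
      have "?h N x = ennreal (\<Sum>P\<in>stops w N. 2 * 6 ^ ?n * mean w (fst P) (snd P)
        * indicator (cube (centre (fst P) (snd P)) (3 * side (fst P))) x)"
        by (simp add: stop_sum_def sum_distrib_left mult.assoc)
      also have "\<dots> = (\<Sum>P\<in>stops w N. ennreal (2 * 6 ^ ?n * mean w (fst P) (snd P)
        * indicator (cube (centre (fst P) (snd P)) (3 * side (fst P))) x))"
        by (rule sum_ennreal[symmetric]) simp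
      also have "\<dots> = (\<Sum>P\<in>stops w N. ennreal (2 * 6 ^ ?n * mean w (fst P) (snd P))
       * indicator (cube (centre (fst P) (snd P)) (3 * side (fst P))) x)"
        by (intro sum.cong refl) (simp add: indicator_def)
      finally show "?h N x = \<dots>" .
    qed
    also have "\<dots> = (\<Sum>P\<in>stops w N. ennreal (2 * 6 ^ ?n * mean w (fst P) (snd P))
      * emeasure lebesgue (cube (centre (fst P) (snd P)) (3 * side (fst P))))"
      by (subst nn_integral_sum) (auto intro!: sum.cong nn_integral_cmult_indicator simp del: emeasure_completion)
    also have "\<dots> = (\<Sum>P\<in>stops w N. ennreal (2 * 18 ^ ?n) * wmeas w (cell (fst P) (snd P)))"
    proof (intro sum.cong refl)
      fix P :: "nat \<times> (int^'n)"
      have "(6::real) ^ ?n * 3 ^ ?n = 18 ^ ?n"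
        by (simp add: power_mult_distrib[symmetric])
      then have "2 * 6 ^ ?n * mean w (fst P) (snd P) * (3 * side (fst P)) ^ ?n
        = 2 * 18 ^ ?n * (mean w (fst P) (snd P) * side (fst P) ^ ?n)"
        by (simp add: power_mult_distrib mult_ac)
      then show "ennreal (2 * 6 ^ ?n * mean w (fst P) (snd P))
        * emeasure lebesgue (cube (centre (fst P) (snd P)) (3 * side (fst P)))
        = ennreal (2 * 18 ^ ?n) * wmeas w (cell (fst P) (snd P))"
        by (simp add: emeasure_lebesgue_cube wmeas_cell_eq_mean[OF w] ennreal_mult[symmetric] del: emeasure_completion)
    qed
    finally show "(\<integral>\<^sup>+x. ?h N x \<partial>lebesgue)
      \<le> ennreal (2 * 18 ^ ?n) * (\<Sum>P\<in>stops w N. wmeas w (cell (fst P) (snd P)))"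
      by (simp add: sum_distrib_left)
  qed simp
  finally show ?thesis .
qed

end

section \<open>Comparison of the two suprema\<close>

definition osc_sup :: "(real^'n \<Rightarrow> real) \<Rightarrow> ennreal" where
  "osc_sup w = (SUP f\<in>{f. locally_integrable f \<and> bmo_norm f = 1}. weighted_oscillation w f)"

lemma avg_scale: "avg (\<lambda>x. t * f x) Q = t * avg f Q"
  by (simp add: avg_def)

lemma nn_integral_osc_scale:
  assumes "f \<in> borel_measurable lebesgue" "Q \<in> sets lebesgue" "0 \<le> t"
    and "v \<in> borel_measurable lebesgue" "\<And>x. 0 \<le> v x"
  shows "(\<integral>\<^sup>+x\<in>Q. ennreal (\<bar>t * f x - avg (\<lambda>x. t * f x) Q\<bar> * v x) \<partial>lebesgue)
    = ennreal t * (\<integral>\<^sup>+x\<in>Q. ennreal (\<bar>f x - avg f Q\<bar> * v x) \<partial>lebesgue)"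
proof -
  note [measurable] = assms(1,2,4)
  have "(\<integral>\<^sup>+x\<in>Q. ennreal (\<bar>t * f x - avg (\<lambda>x. t * f x) Q\<bar> * v x) \<partial>lebesgue)
    = (\<integral>\<^sup>+x. ennreal t * (ennreal (\<bar>f x - avg f Q\<bar> * v x) * indicator Q x) \<partial>lebesgue)"
  proof (intro nn_integral_cong)
    fix x
    have "\<bar>t * f x - avg (\<lambda>x. t * f x) Q\<bar> = t * \<bar>f x - avg f Q\<bar>"
      using assms(3) by (simp add: avg_scale right_diff_distrib[symmetric] abs_mult)
    then show "ennreal (\<bar>t * f x - avg (\<lambda>x. t * f x) Q\<bar> * v x) * indicator Q x
      = ennreal t * (ennreal (\<bar>f x - avg f Q\<bar> * v x) * indicator Q x)"
      using assms(3,5) by (simp add: ennreal_mult[symmetric] mult.assoc[symmetric] del: mult.assoc)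
  qed
  also have "\<dots> = ennreal t * (\<integral>\<^sup>+x\<in>Q. ennreal (\<bar>f x - avg f Q\<bar> * v x) \<partial>lebesgue)"
    by (intro nn_integral_cmult) measurable
  finally show ?thesis .
qed

lemma bmo_norm_scale:
  assumes "locally_integrable f" "0 \<le> t"
  shows "bmo_norm (\<lambda>x. t * f x) = ennreal t * bmo_norm f"
proof -
  have "(\<integral>\<^sup>+x\<in>cube c l. ennreal \<bar>t * f x - avg (\<lambda>x. t * f x) (cube c l)\<bar> \<partial>lebesgue)
    = ennreal t * (\<integral>\<^sup>+x\<in>cube c l. ennreal \<bar>f x - avg f (cube c l)\<bar> \<partial>lebesgue)" for c l
    using nn_integral_osc_scale[OF locally_integrable_borel_measurable[OF assms(1)] sets_lebesgue_cube assms(2), of "\<lambda>_. 1"]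
    by simp
  then show ?thesis
    unfolding bmo_norm_def
    by (simp add: SUP_mult_left_ennreal ennreal_times_divide case_prod_unfold)
qed

lemma locally_integrable_scale: "locally_integrable f \<Longrightarrow> locally_integrable (\<lambda>x. t * f x)"
  by (simp add: locally_integrable_def set_integrable_mult_right)

text \<open>Normalising \<open>f\<close> to BMO norm \<open>1\<close> is impossible exactly when \<open>f\<close> is almost everywhere constant on every
cube, and then it does not oscillate at all.\<close>

lemma oscillation_le_osc_sup:
  fixes f w :: "real^'n \<Rightarrow> real"
  assumes f: "locally_integrable f" "bmo_norm f \<le> ennreal B" and w: "weight w" and l: "0 < l"
  shows "(\<integral>\<^sup>+x\<in>cube c l. ennreal (\<bar>f x - avg f (cube c l)\<bar> * w x) \<partial>lebesgue)
    \<le> ennreal B * osc_sup w * wmeas w (cube c (2 * l))"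
proof -
  let ?Q = "cube c l" and ?W = "wmeas w (cube c (2 * l))"
  let ?O = "\<integral>\<^sup>+x\<in>?Q. ennreal (\<bar>f x - avg f ?Q\<bar> * w x) \<partial>lebesgue"
  note [measurable] = locally_integrable_borel_measurable[OF f(1)] weight_borel_measurable[OF w]
  have W_fin: "?W < top"
    using wmeas_cube_finite[OF w, of c "2 * l"] by simp
  have "?Q \<subseteq> cube c (2 * l)"
    using l by (intro cube_subset_cube) (simp add: infnorm_0)
  then have W_ge: "wmeas w ?Q \<le> ?W"
    by (rule wmeas_mono)
  obtain r where r: "bmo_norm f = ennreal r" "0 \<le> r"
    using f(2) by (cases "bmo_norm f") (auto simp: top_unique)
  show ?thesis
  proof (cases "r = 0 \<or> ?W = 0")
    case True
    have "?O = 0"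
    proof (cases "r = 0")
      case True
      have "(\<integral>\<^sup>+x\<in>?Q. ennreal \<bar>f x - avg f ?Q\<bar> \<partial>lebesgue) \<le> ennreal (0 * l ^ CARD('n))"
        using r True l by (intro osc_le_of_bmo_norm) auto
      then have "(\<integral>\<^sup>+x\<in>?Q. ennreal \<bar>f x - avg f ?Q\<bar> \<partial>lebesgue) = 0"
        by simp
      then have "AE x in lebesgue. ennreal \<bar>f x - avg f ?Q\<bar> * indicator ?Q x = 0"
        by (subst (asm) nn_integral_0_iff_AE) auto
      then have "AE x in lebesgue. ennreal (\<bar>f x - avg f ?Q\<bar> * w x) * indicator ?Q x = 0"
        by eventually_elim (auto simp: indicator_def)
      then show ?thesis
        by (subst nn_integral_0_iff_AE) auto
    next
      case False
      then have "wmeas w ?Q = 0"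
        using True W_ge by simp
      then have "AE x in lebesgue. ennreal (w x) * indicator ?Q x = 0"
        unfolding wmeas_def by (subst (asm) nn_integral_0_iff_AE) auto
      then have "AE x in lebesgue. ennreal (\<bar>f x - avg f ?Q\<bar> * w x) * indicator ?Q x = 0"
      proof eventually_elim
        fix x assume "ennreal (w x) * indicator ?Q x = 0"
        then have "w x = 0" if "x \<in> ?Q"
          using that weight_nonneg[OF w, of x] by (simp add: ennreal_eq_0_iff)
        then show "ennreal (\<bar>f x - avg f ?Q\<bar> * w x) * indicator ?Q x = 0"
          by (cases "x \<in> ?Q") simp_all
      qed
      then show ?thesis
        by (subst nn_integral_0_iff_AE) auto
    qed
    then show ?thesis by simp
  next
    case False
    then have r_pos: "0 < r" and W_pos: "0 < ?W"
      using r(2) by (auto simp: zero_less_iff_neq_zero)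
    let ?g = "\<lambda>x. (1 / r) * f x"
    have g: "locally_integrable ?g" "bmo_norm ?g = 1"
      using r r_pos bmo_norm_scale[OF f(1), of "1 / r"]
      by (simp_all only: locally_integrable_scale[OF f(1)])
         (simp add: ennreal_mult[symmetric])
    let ?G = "\<integral>\<^sup>+x\<in>?Q. ennreal (\<bar>?g x - avg ?g ?Q\<bar> * w x) \<partial>lebesgue"
    have "?G / ?W \<le> weighted_oscillation w ?g"
      unfolding weighted_oscillation_def using l W_pos by (intro SUP_upper2[of "(c, l)"]) auto
    also have "\<dots> \<le> osc_sup w"
      unfolding osc_sup_def using g by (intro SUP_upper) simp
    finally have G: "?G \<le> osc_sup w * ?W"
      using W_pos W_fin by (simp add: ennreal_divide_le_iff)
    have "?O = ennreal r * ?G"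
      using r_pos weight_nonneg[OF w]
      by (subst nn_integral_osc_scale) (auto simp: ennreal_mult[symmetric] mult.assoc[symmetric])
    also have "\<dots> \<le> ennreal B * (osc_sup w * ?W)"
      using G f(2) r(1) by (intro mult_mono) auto
    finally show ?thesis by (simp add: mult.assoc)
  qed
qed

lemma bmo_norm_le_of_bounded:
  fixes f :: "real^'n \<Rightarrow> real"
  assumes "locally_integrable f" "\<And>x. \<bar>f x\<bar> \<le> 1"
  shows "bmo_norm f \<le> ennreal 2"
proof -
  have "bmo_norm f \<le> ennreal (2 * 1)"
  proof (rule bmo_norm_leI[OF assms(1)])
    fix c :: "real^'n" and l :: real assume l: "0 < l"
    have "(\<integral>\<^sup>+x\<in>cube c l. ennreal \<bar>f x - 0\<bar> \<partial>lebesgue) \<le> (\<integral>\<^sup>+x. indicator (cube c l) x \<partial>lebesgue)"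
      using assms(2) by (intro nn_integral_mono) (auto simp: indicator_def)
    also have "\<dots> = ennreal (1 * l ^ CARD('n))"
      using l by (simp add: emeasure_lebesgue_cube del: emeasure_completion)
    finally show "\<exists>b. (\<integral>\<^sup>+x\<in>cube c l. ennreal \<bar>f x - b\<bar> \<partial>lebesgue) \<le> ennreal (1 * l ^ CARD('n))" ..
  qed simp
  then show ?thesis by simp
qed

context dyadic_grid
begin

lemma locally_integrable_indicator_cell: "locally_integrable (indicator (cell k m))"
  unfolding locally_integrable_def set_integrable_def
proof (intro allI impI)
  fix K :: "(real^'n) set" assume "compact K"
  then have "K \<inter> cell k m \<in> lmeasurable"
    by (intro fmeasurable_Int_fmeasurable lmeasurable_compact) simp_all
  then have "integrable lebesgue (indicator (K \<inter> cell k m) :: _ \<Rightarrow> real)"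
    by (simp add: fmeasurable_def integrable_indicator_iff del: emeasure_completion)
  then show "integrable lebesgue (\<lambda>x. indicator K x *\<^sub>R (indicator (cell k m) x :: real))"
    by (simp add: indicator_inter_arith[symmetric])
qed

text \<open>The indicator of one child of \<open>Q\<close> has average \<open>p = 2^(-n) \<le> 1/2\<close> over \<open>Q\<close> and values \<open>0\<close> and \<open>1\<close>, so it
differs from its average by at least \<open>p\<close> at every point.\<close>

lemma wmeas_closed_cell_0_le_osc_sup:
  assumes w: "weight w"
  shows "wmeas w (closed_cell 0 0) \<le> ennreal (2 * 2 ^ CARD('n)) * osc_sup w * wmeas w (cube (centre 0 0) (2 * L))"
proof -
  let ?n = "CARD('n)" and ?f = "indicator (cell 1 0) :: real^'n \<Rightarrow> real"
  let ?Q = "closed_cell 0 0"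
  define p :: real where "p = 1 / 2 ^ ?n"
  have p: "0 < p" "p \<le> 1 / 2"
    using power_increasing[of 1 ?n "2::real"] by (auto simp: p_def field_simps)
  note [measurable] = weight_borel_measurable[OF w]
  have sub: "cell 1 0 \<subseteq> ?Q"
    using cell_subset_anc[of 0 1 0] cell_subset_closed_cell[of 0 0] by (auto simp: anc_def zero_vec_def)
  have "(LINT x:?Q|lebesgue. ?f x) = (LINT x|lebesgue. ?f x)"
    unfolding set_lebesgue_integral_def
    using sub by (intro Bochner_Integration.integral_cong) (auto simp: indicator_def)
  also have "\<dots> = side 1 ^ ?n"
    by (simp add: measure_cell)
  finally have avg: "avg ?f ?Q = p"
    using L_pos by (simp add: avg_def measure_lebesgue_cube side_def p_def power_divide)
  have "ennreal p * wmeas w ?Q = (\<integral>\<^sup>+x. ennreal p * (ennreal (w x) * indicator ?Q x) \<partial>lebesgue)"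
    unfolding wmeas_def by (intro nn_integral_cmult[symmetric]) measurable
  also have "\<dots> \<le> (\<integral>\<^sup>+x\<in>?Q. ennreal (\<bar>?f x - avg ?f ?Q\<bar> * w x) \<partial>lebesgue)"
  proof (intro nn_integral_mono)
    fix x
    have "p * w x \<le> \<bar>?f x - avg ?f ?Q\<bar> * w x"
      unfolding avg using p weight_nonneg[OF w, of x] by (intro mult_right_mono) (auto simp: indicator_def)
    then have "ennreal p * ennreal (w x) \<le> ennreal (\<bar>?f x - avg ?f ?Q\<bar> * w x)"
      using p weight_nonneg[OF w, of x] by (simp add: ennreal_mult[symmetric] ennreal_leI)
    then show "ennreal p * (ennreal (w x) * indicator ?Q x)
      \<le> ennreal (\<bar>?f x - avg ?f ?Q\<bar> * w x) * indicator ?Q x"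
      by (cases "x \<in> ?Q") simp_all
  qed
  also have "\<dots> \<le> ennreal 2 * osc_sup w * wmeas w (cube (centre 0 0) (2 * side 0))"
    by (intro oscillation_le_osc_sup bmo_norm_le_of_bounded locally_integrable_indicator_cell w)
       (auto simp: indicator_def L_pos)
  finally have "ennreal (2 ^ ?n) * (ennreal p * wmeas w ?Q)
    \<le> ennreal (2 ^ ?n) * (ennreal 2 * osc_sup w * wmeas w (cube (centre 0 0) (2 * L)))"
    by (intro mult_left_mono) simp_all
  moreover have "ennreal (2 ^ ?n) * (ennreal p * wmeas w ?Q) = wmeas w ?Q"
    by (simp add: p_def mult.assoc[symmetric] ennreal_mult[symmetric] del: mult.assoc)
  moreover have "ennreal (2 ^ ?n) * (ennreal 2 * osc_sup w * wmeas w (cube (centre 0 0) (2 * L)))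
    = ennreal (2 * 2 ^ ?n) * osc_sup w * wmeas w (cube (centre 0 0) (2 * L))"
    by (simp add: ennreal_mult mult_ac)
  ultimately show ?thesis by simp
qed

end

lemma wmeas_cube_le_osc_sup:
  fixes w :: "real^'n \<Rightarrow> real"
  assumes w: "weight w" and l: "0 < l"
  shows "wmeas w (cube c l) \<le> ennreal (2 * 2 ^ CARD('n)) * osc_sup w * wmeas w (cube c (2 * l))"
proof -
  interpret dyadic_grid "c - (\<chi> i. l / 2)" l
    by unfold_locales (rule l)
  have "centre 0 0 = c"
    by (simp add: centre_def vec_eq_iff)
  then show ?thesis
    using wmeas_closed_cell_0_le_osc_sup[OF w] by simp
qed

lemma wmeas_shrink:
  fixes w :: "real^'n \<Rightarrow> real"
  assumes "\<And>c l. 0 < l \<Longrightarrow> wmeas w (cube c l) \<le> \<epsilon> * wmeas w (cube c (2 * l))" "0 < l"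
  shows "wmeas w (cube c (l / 2 ^ k)) \<le> \<epsilon> ^ k * wmeas w (cube c l)"
proof (induction k)
  case 0
  then show ?case by simp
next
  case (Suc k)
  have "wmeas w (cube c (l / 2 ^ Suc k)) \<le> \<epsilon> * wmeas w (cube c (2 * (l / 2 ^ Suc k)))"
    using assms by (intro assms(1)) simp
  also have "\<dots> = \<epsilon> * wmeas w (cube c (l / 2 ^ k))"
    by simp
  also have "\<dots> \<le> \<epsilon> * (\<epsilon> ^ k * wmeas w (cube c l))"
    using Suc by (intro mult_left_mono) auto
  finally show ?case by (simp add: mult.assoc)
qed

text \<open>If passing to the cube of half the side always multiplies the mass by at most \<open>\<epsilon>\<close>, then the \<open>2^(n k)\<close> cells
of generation \<open>k\<close> inside \<open>Q\<close> have mass at most \<open>\<epsilon>^k\<close> times that of a fixed larger cube each.\<close>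

lemma (in dyadic_grid) wmeas_cell_0_le_of_shrinking:
  assumes w: "weight w"
    and shrink: "\<And>c l. 0 < l \<Longrightarrow> wmeas w (cube c l) \<le> ennreal \<epsilon> * wmeas w (cube c (2 * l))"
    and \<epsilon>: "0 \<le> \<epsilon>"
  shows "wmeas w (cell 0 0) \<le> ennreal ((2 ^ CARD('n) * \<epsilon>) ^ k) * wmeas w (cube (centre 0 0) (2 * L))"
proof -
  let ?J = "{m. anc k 0 m = 0}" and ?W = "wmeas w (cube (centre 0 0) (2 * L))"
  have closed: "closed_cell k m \<subseteq> closed_cell 0 0" if "m \<in> ?J" for m
    using closed_cell_subset_anc[of 0 k m] that by simp
  then have sub: "cell k m \<subseteq> closed_cell 0 0" if "m \<in> ?J" for m
    using cell_subset_closed_cell[of k m] that by blast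
  have fin: "finite ?J"
    by (rule finite_subset[OF _ finite_cells_in_cube[of k "centre 0 0" "side 0"]]) (use sub in blast)
  have "real (card ?J) * side k ^ CARD('n) \<le> side 0 ^ CARD('n)"
    using fin sub by (intro sum_volume_cells_le[OF _ _ side_nonneg]) auto
  also have "side 0 ^ CARD('n) = (2 ^ CARD('n)) ^ k * side k ^ CARD('n)"
  proof -
    have "(side k * 2 ^ k) ^ CARD('n) = (2 ^ CARD('n)) ^ k * side k ^ CARD('n)"
      by (simp add: power_mult_distrib power_mult[symmetric] mult.commute[of k])
    then show ?thesis
      by (simp only: side_shift[OF le0, of k] diff_zero)
  qed
  finally have card_J: "real (card ?J) \<le> (2 ^ CARD('n)) ^ k"
    by simp
  have cell_le: "wmeas w (cell k m) \<le> ennreal (\<epsilon> ^ k) * ?W" if m: "m \<in> ?J" for m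
  proof -
    have "wmeas w (cell k m) = wmeas w (cube (centre k m) (L / 2 ^ k))"
      by (simp add: wmeas_closed_cell[symmetric] side_def)
    also have "\<dots> \<le> ennreal \<epsilon> ^ k * wmeas w (cube (centre k m) L)"
      by (rule wmeas_shrink[OF shrink L_pos])
    also have "\<dots> \<le> ennreal \<epsilon> ^ k * ?W"
    proof (intro mult_left_mono wmeas_mono cube_subset_cube)
      have "centre k m \<in> closed_cell k m"
        by (simp add: mem_cube_iff_infnorm infnorm_0)
      then have "centre k m \<in> closed_cell 0 0"
        using closed[OF m] by blast
      then show "infnorm (centre k m - centre 0 0) + L / 2 \<le> 2 * L / 2"
        by (simp add: mem_cube_iff_infnorm)
    qed simp
    finally show ?thesis
      using \<epsilon> by (simp add: ennreal_power)
  qed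
  have "cell 0 0 \<subseteq> (\<Union>m\<in>?J. cell k m)"
  proof
    fix y assume "y \<in> cell 0 0"
    then have "idx k y \<in> ?J"
      using idx_eq_anc[of 0 k y] by (simp add: mem_cell_iff_idx)
    then show "y \<in> (\<Union>m\<in>?J. cell k m)"
      using mem_cell_idx by blast
  qed
  then have "wmeas w (cell 0 0) \<le> wmeas w (\<Union>m\<in>?J. cell k m)"
    by (rule wmeas_mono)
  also have "\<dots> = (\<Sum>m\<in>?J. wmeas w (cell k m))"
    unfolding wmeas_def using weight_borel_measurable[OF w] fin
    by (intro nn_integral_finite_Union_disjoint disjoint_cells) (auto intro: measurable_compose)
  also have "\<dots> \<le> (\<Sum>m\<in>?J. ennreal (\<epsilon> ^ k) * ?W)"
    by (intro sum_mono cell_le)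
  also have "\<dots> = ennreal (real (card ?J)) * (ennreal (\<epsilon> ^ k) * ?W)"
    by (simp add: ennreal_of_nat_eq_real_of_nat)
  also have "\<dots> \<le> ennreal ((2 ^ CARD('n)) ^ k) * (ennreal (\<epsilon> ^ k) * ?W)"
    using card_J by (intro mult_right_mono ennreal_leI) auto
  also have "\<dots> = ennreal ((2 ^ CARD('n) * \<epsilon>) ^ k) * ?W"
    using \<epsilon> by (simp add: mult.assoc[symmetric] ennreal_mult[symmetric] power_mult_distrib del: mult.assoc)
  finally show ?thesis .
qed

text \<open>If the supremum were below \<open>1 / (4 * 4^n)\<close>, halving a cube would multiply its mass by at most \<open>2^(-n) / 2\<close>.  This is
less than the share \<open>2^(-n)\<close> of an average child, so \<open>w\<close> would be null.\<close>

lemma osc_sup_lower_bound: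
  fixes w :: "real^'n \<Rightarrow> real"
  assumes w: "weight w" and l: "0 < l" and pos: "0 < wmeas w (cube c l)"
  shows "1 \<le> ennreal (4 * 4 ^ CARD('n)) * osc_sup w"
proof (rule ccontr)
  let ?n = "CARD('n)"
  define \<delta> :: real where "\<delta> = 1 / (4 * 4 ^ ?n)"
  interpret dyadic_grid "c - (\<chi> i. l / 2)" l
    by unfold_locales (rule l)
  have c: "centre 0 0 = c"
    by (simp add: centre_def vec_eq_iff)
  have \<delta>: "0 < \<delta>" by (simp add: \<delta>_def)
  assume "\<not> 1 \<le> ennreal (4 * 4 ^ ?n) * osc_sup w"
  then have "ennreal (4 * 4 ^ ?n) * osc_sup w \<le> 1" by simp
  then have "ennreal \<delta> * (ennreal (4 * 4 ^ ?n) * osc_sup w) \<le> ennreal \<delta> * 1"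
    by (intro mult_left_mono) auto
  moreover have "ennreal \<delta> * (ennreal (4 * 4 ^ ?n) * osc_sup w) = osc_sup w"
    using \<delta> by (simp add: \<delta>_def mult.assoc[symmetric] ennreal_mult[symmetric] del: mult.assoc)
  ultimately have small: "osc_sup w \<le> ennreal \<delta>" by simp
  let ?\<epsilon> = "2 * 2 ^ ?n * \<delta>"
  have shrink: "wmeas w (cube c l) \<le> ennreal ?\<epsilon> * wmeas w (cube c (2 * l))" if "0 < l" for c l
  proof -
    have "wmeas w (cube c l) \<le> ennreal (2 * 2 ^ ?n) * osc_sup w * wmeas w (cube c (2 * l))"
      by (rule wmeas_cube_le_osc_sup[OF w that])
    also have "\<dots> \<le> ennreal (2 * 2 ^ ?n) * ennreal \<delta> * wmeas w (cube c (2 * l))"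
      by (intro mult_right_mono mult_left_mono small) auto
    also have "ennreal (2 * 2 ^ ?n) * ennreal \<delta> = ennreal ?\<epsilon>"
      using \<delta> by (simp add: ennreal_mult[symmetric])
    finally show ?thesis .
  qed
  have half: "2 ^ ?n * ?\<epsilon> = 1 / 2"
  proof -
    have "(2::real) ^ ?n * 2 ^ ?n = 4 ^ ?n"
      by (simp add: power_mult_distrib[symmetric])
    then show ?thesis by (simp add: \<delta>_def)
  qed
  obtain W where W: "wmeas w (cube c (2 * l)) = ennreal W" "0 \<le> W"
    using wmeas_cube_finite[OF w, of c "2 * l"] by (cases "wmeas w (cube c (2 * l))") auto
  have "wmeas w (cube c l) = wmeas w (cell 0 0)"
    using wmeas_closed_cell[of w 0 0] c by simp
  then have le: "wmeas w (cube c l) \<le> ennreal ((1 / 2) ^ k * W)" for k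
    using wmeas_cell_0_le_of_shrinking[OF w shrink, of k] \<delta> W
    unfolding half c by (simp add: ennreal_mult)
  have "(\<lambda>k. ennreal ((1 / 2) ^ k * W)) \<longlonglongrightarrow> ennreal (0 * W)"
    by (intro tendsto_intros LIMSEQ_power_zero) auto
  then have "wmeas w (cube c l) \<le> ennreal (0 * W)"
    by (rule LIMSEQ_le_const) (use le in blast)
  then show False
    using pos by simp
qed

context dyadic_grid
begin

text \<open>The test function is the sum of the tents over the selected cells.\<close>

lemma sum_wmeas_stops_le:
  assumes w: "weight w"
  shows "(\<Sum>P\<in>stops w N. wmeas w (cell (fst P) (snd P)))
    \<le> ennreal (12 * 12 ^ CARD('n) + 4 * 4 ^ CARD('n)) * osc_sup w * wmeas w (cube (centre 0 0) (2 * L))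
      + ennreal (6 * 2 ^ CARD('n)) * wmeas w (closed_cell 0 0)"
proof (cases "mean w 0 0 = 0")
  case True
  have "wmeas w (cell (fst P) (snd P)) = 0" if "P \<in> stops w N" for P
    using wmeas_mono[OF cell_stop_subset[OF that], of w] True by (simp add: wmeas_cell_eq_mean[OF w, of 0])
  then show ?thesis by simp
next
  case False
  then have pos: "0 < mean w 0 0"
    using mean_nonneg[of w 0 0] by linarith
  let ?n = "CARD('n)" and ?F = "stops w N" and ?Q = "closed_cell 0 0"
  let ?f = "tent_sum ?F"
  have packed: "packed 3 ?F"
    by (rule packed_stops[OF w pos])
  note [measurable] = weight_borel_measurable[OF w] borel_measurable_tent
  have li: "locally_integrable ?f"
    by (rule locally_integrable_tent_sum)
  have f_nonneg: "0 \<le> ?f x" for x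
    by (intro sum_nonneg) simp
  have "ennreal (\<bar>avg ?f ?Q - 0\<bar> * measure lebesgue ?Q) \<le> (\<integral>\<^sup>+x\<in>?Q. ennreal \<bar>?f x - 0\<bar> \<partial>lebesgue)"
    by (intro abs_avg_minus_const_le locally_integrable_set_integrable li) simp
  also have "\<dots> \<le> (\<integral>\<^sup>+x. (\<Sum>P\<in>?F. ennreal (cell_tent P x)) \<partial>lebesgue)"
    using f_nonneg by (intro nn_integral_mono) (auto simp: indicator_def)
  also have "\<dots> = (\<Sum>P\<in>?F. \<integral>\<^sup>+x. ennreal (cell_tent P x) \<partial>lebesgue)"
    by (intro nn_integral_sum) measurable
  also have "\<dots> \<le> (\<Sum>P\<in>?F. ennreal (2 * 2 ^ ?n * side (fst P) ^ ?n))"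
    by (intro sum_mono nn_integral_tent_le) simp
  also have "\<dots> = ennreal (2 * 2 ^ ?n * (\<Sum>P\<in>?F. side (fst P) ^ ?n))"
    by (simp add: sum_distrib_left)
  also have "(\<Sum>P\<in>?F. side (fst P) ^ ?n)
    = (\<Sum>P\<in>{P\<in>?F. 0 \<le> fst P \<and> anc (fst P) 0 (snd P) = 0}. side (fst P) ^ ?n)"
    by (rule sum.cong) (auto simp: stops_def)
  also have "ennreal (2 * 2 ^ ?n * \<dots>) \<le> ennreal (2 * 2 ^ ?n * (3 * side 0 ^ ?n))"
    using packed[unfolded packed_def, THEN conjunct2, rule_format, of 0 0]
    by (intro ennreal_leI mult_left_mono) simp_all
  finally have "\<bar>avg ?f ?Q\<bar> * L ^ ?n \<le> 6 * 2 ^ ?n * L ^ ?n"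
    using L_pos by (simp add: measure_lebesgue_cube)
  then have avg: "avg ?f ?Q \<le> 6 * 2 ^ ?n"
    using L_pos by simp
  have "(\<Sum>P\<in>?F. wmeas w (cell (fst P) (snd P)))
    = (\<integral>\<^sup>+x. (\<Sum>P\<in>?F. ennreal (w x) * indicator (cell (fst P) (snd P)) x) \<partial>lebesgue)"
    unfolding wmeas_def by (intro nn_integral_sum[symmetric]) measurable
  also have "\<dots> \<le> (\<integral>\<^sup>+x. ennreal (\<bar>?f x - avg ?f ?Q\<bar> * w x) * indicator ?Q x
      + ennreal (6 * 2 ^ ?n) * (ennreal (w x) * indicator ?Q x) \<partial>lebesgue)"
  proof (intro nn_integral_mono)
    fix x
    show "(\<Sum>P\<in>?F. ennreal (w x) * indicator (cell (fst P) (snd P)) x)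
      \<le> ennreal (\<bar>?f x - avg ?f ?Q\<bar> * w x) * indicator ?Q x
      + ennreal (6 * 2 ^ ?n) * (ennreal (w x) * indicator ?Q x)"
    proof (cases "x \<in> ?Q")
      case True
      have "(\<Sum>P\<in>?F. ennreal (w x) * indicator (cell (fst P) (snd P)) x)
        \<le> (\<Sum>P\<in>?F. ennreal (w x) * ennreal (cell_tent P x))"
      proof (intro sum_mono mult_left_mono)
        fix P
        have "1 \<le> cell_tent P x" if "x \<in> cell (fst P) (snd P)"
          by (rule tent_ge_1[OF side_pos subsetD[OF cell_subset_closed_cell that]])
        then show "indicator (cell (fst P) (snd P)) x \<le> ennreal (cell_tent P x)"
          by (auto simp: indicator_def)
      qed simp
      also have "\<dots> = ennreal (?f x * w x)"
        using weight_nonneg[OF w, of x] f_nonneg[of x]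
        by (simp add: sum_distrib_left[symmetric] ennreal_mult mult.commute)
      also have "\<dots> \<le> ennreal (\<bar>?f x - avg ?f ?Q\<bar> * w x + 6 * 2 ^ ?n * w x)"
      proof (intro ennreal_leI)
        have "?f x * w x \<le> (\<bar>?f x - avg ?f ?Q\<bar> + 6 * 2 ^ ?n) * w x"
          by (rule mult_right_mono) (use avg weight_nonneg[OF w, of x] in linarith)+
        then show "?f x * w x \<le> \<bar>?f x - avg ?f ?Q\<bar> * w x + 6 * 2 ^ ?n * w x"
          by (simp only: distrib_right)
      qed
      also have "\<dots> = ennreal (\<bar>?f x - avg ?f ?Q\<bar> * w x) + ennreal (6 * 2 ^ ?n) * ennreal (w x)"
        using weight_nonneg[OF w, of x] by (simp add: ennreal_mult)
      finally show ?thesis using True by simp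
    next
      case False
      then have "x \<notin> cell (fst P) (snd P)" if "P \<in> ?F" for P
        using cell_stop_subset[OF that] cell_subset_closed_cell[of 0 0] by blast
      then show ?thesis by simp
    qed
  qed
  also have "\<dots> = (\<integral>\<^sup>+x\<in>?Q. ennreal (\<bar>?f x - avg ?f ?Q\<bar> * w x) \<partial>lebesgue) + ennreal (6 * 2 ^ ?n) * wmeas w ?Q"
    unfolding wmeas_def by (subst nn_integral_add) (measurable, simp add: nn_integral_cmult)
  also have "(\<integral>\<^sup>+x\<in>?Q. ennreal (\<bar>?f x - avg ?f ?Q\<bar> * w x) \<partial>lebesgue)
    \<le> ennreal (12 * 12 ^ ?n + 4 * 4 ^ ?n) * osc_sup w * wmeas w (cube (centre 0 0) (2 * side 0))"
    using bmo_norm_tent_sum_le[OF packed] L_pos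
    by (intro oscillation_le_osc_sup li w) (simp_all add: algebra_simps)
  finally show ?thesis by simp
qed

end

theorem maximal_le_oscillation:
  fixes w :: "real^'n \<Rightarrow> real"
  assumes w: "weight w" and l: "0 < l" and pos: "0 < wmeas w (cube c (2 * l))"
  shows "(\<integral>\<^sup>+x\<in>cube c l. maximal_op (\<lambda>y. w y * indicator (cube c l) y) x \<partial>lebesgue)
    \<le> ennreal (2 * 18 ^ CARD('n) * (12 * 12 ^ CARD('n) + 4 * 4 ^ CARD('n) + 24 * 8 ^ CARD('n)))
      * osc_sup w * wmeas w (cube c (2 * l))"
proof -
  let ?n = "CARD('n)" and ?W = "wmeas w (cube c (2 * l))" and ?S = "osc_sup w"
  let ?B = "12 * 12 ^ ?n + 4 * 4 ^ ?n :: real"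
  interpret dyadic_grid "c - (\<chi> i. l / 2)" l
    by unfold_locales (rule l)
  have c: "centre 0 0 = c"
    by (simp add: centre_def vec_eq_iff)
  have "closed_cell 0 0 \<subseteq> cube c (2 * l)"
    using l c by (intro cube_subset_cube) (simp add: infnorm_0)
  then have Q_le: "wmeas w (closed_cell 0 0) \<le> ?W"
    by (rule wmeas_mono)
  have "(\<integral>\<^sup>+x\<in>closed_cell 0 0. maximal_op (\<lambda>y. w y * indicator (closed_cell 0 0) y) x \<partial>lebesgue)
    \<le> (SUP N. ennreal (2 * 18 ^ ?n) * (\<Sum>P\<in>stops w N. wmeas w (cell (fst P) (snd P))))"
    by (rule integral_maximal_op_le[OF w])
  also have "\<dots> \<le> ennreal (2 * 18 ^ ?n) * (ennreal ?B * ?S * ?W + ennreal (24 * 8 ^ ?n) * ?S * ?W)"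
  proof (intro SUP_least mult_left_mono)
    fix N
    have "(\<Sum>P\<in>stops w N. wmeas w (cell (fst P) (snd P)))
      \<le> ennreal ?B * ?S * ?W + ennreal (6 * 2 ^ ?n) * wmeas w (closed_cell 0 0)"
      using sum_wmeas_stops_le[OF w, of N] unfolding c .
    also have "ennreal (6 * 2 ^ ?n) * wmeas w (closed_cell 0 0)
      \<le> ennreal (6 * 2 ^ ?n) * (ennreal (4 * 4 ^ ?n) * ?S * ?W)"
    proof (intro mult_left_mono)
      have "1 * wmeas w (closed_cell 0 0) \<le> ennreal (4 * 4 ^ ?n) * ?S * ?W"
        using l by (intro mult_mono Q_le osc_sup_lower_bound[OF w _ pos]) auto
      then show "wmeas w (closed_cell 0 0) \<le> ennreal (4 * 4 ^ ?n) * ?S * ?W"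
        by simp
    qed simp
    also have "ennreal (6 * 2 ^ ?n) * (ennreal (4 * 4 ^ ?n) * ?S * ?W) = ennreal (24 * 8 ^ ?n) * ?S * ?W"
    proof -
      have "(2::real) ^ ?n * 4 ^ ?n = 8 ^ ?n"
        by (simp add: power_mult_distrib[symmetric])
      then have "6 * 2 ^ ?n * (4 * 4 ^ ?n) = 24 * (8::real) ^ ?n"
        by (simp add: mult_ac)
      then show ?thesis
        by (simp only: mult.assoc[symmetric]) (simp add: ennreal_mult[symmetric])
    qed
    finally show "(\<Sum>P\<in>stops w N. wmeas w (cell (fst P) (snd P)))
      \<le> ennreal ?B * ?S * ?W + ennreal (24 * 8 ^ ?n) * ?S * ?W"
      by (simp add: add_left_mono)
  qed simp
  also have "\<dots> = ennreal (2 * 18 ^ ?n * (?B + 24 * 8 ^ ?n)) * ?S * ?W"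
  proof -
    have "ennreal a * (ennreal b * ?S * ?W + ennreal d * ?S * ?W) = ennreal (a * (b + d)) * ?S * ?W"
      if "0 \<le> a" "0 \<le> b" "0 \<le> d" for a b d
      using that by (simp add: ennreal_mult ennreal_plus distrib_left distrib_right mult.assoc)
    from this[of "2 * 18 ^ ?n" ?B "24 * 8 ^ ?n"] show ?thesis
      by (simp only: zero_le_numeral zero_le_power mult_nonneg_nonneg add_nonneg_nonneg)
  qed
  finally show ?thesis
    using c by simp
qed

theorem corollary2p3:
  shows "\<exists>C>0. \<forall>w :: real^'n \<Rightarrow> real. weight w \<longrightarrow>
    weak_Ainf w \<le> ennreal C *
      (SUP f\<in>{f. locally_integrable f \<and> bmo_norm f = 1}. weighted_oscillation w f) \<and>
    (SUP f\<in>{f. locally_integrable f \<and> bmo_norm f = 1}. weighted_oscillation w f)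
      \<le> ennreal C * weak_Ainf w"
proof -
  let ?n = "CARD('n)"
  define A B :: real where "A = 2 * 18 ^ ?n * (12 * 12 ^ ?n + 4 * 4 ^ ?n + 24 * 8 ^ ?n)" and "B = 7 + 4 * 2 ^ ?n"
  have AB: "0 < A" "0 < B"
    by (auto simp: A_def B_def intro!: mult_pos_pos add_pos_pos)
  have upper: "weak_Ainf w \<le> ennreal A * osc_sup w" if w: "weight w" for w :: "real^'n \<Rightarrow> real"
    unfolding weak_Ainf_def
  proof (rule SUP_least, clarify)
    fix c :: "real^'n" and l :: real
    assume l: "0 < l" and pos: "0 < wmeas w (cube c (2 * l))"
    show "(\<integral>\<^sup>+x\<in>cube c l. maximal_op (\<lambda>y. w y * indicator (cube c l) y) x \<partial>lebesgue)
       / wmeas w (cube c (2 * l)) \<le> ennreal A * osc_sup w"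
      using maximal_le_oscillation[OF w l pos] pos wmeas_cube_finite[OF w, of c "2 * l"]
      by (subst ennreal_divide_le_iff) (simp_all add: A_def)
  qed
  have lower: "osc_sup w \<le> ennreal B * weak_Ainf w" if w: "weight w" for w :: "real^'n \<Rightarrow> real"
    unfolding osc_sup_def
  proof (rule SUP_least, clarify)
    fix f :: "real^'n \<Rightarrow> real" assume f: "locally_integrable f" "bmo_norm f = 1"
    show "weighted_oscillation w f \<le> ennreal B * weak_Ainf w"
      unfolding weighted_oscillation_def
    proof (rule SUP_least, clarify)
      fix c :: "real^'n" and l :: real
      assume l: "0 < l" and pos: "0 < wmeas w (cube c (2 * l))"
      let ?W = "wmeas w (cube c (2 * l))"
      let ?M = "\<integral>\<^sup>+x\<in>cube c l. maximal_op (\<lambda>y. w y * indicator (cube c l) y) x \<partial>lebesgue"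
      have "(\<integral>\<^sup>+x\<in>cube c l. ennreal (\<bar>f x - avg f (cube c l)\<bar> * w x) \<partial>lebesgue) / ?W \<le> (ennreal B * ?M) / ?W"
        using oscillation_le_maximal[OF f(1) _ w l, of c] f(2)
        by (intro divide_right_mono_ennreal) (simp add: B_def)
      also have "\<dots> = ennreal B * (?M / ?W)"
        by (simp add: ennreal_times_divide)
      also have "\<dots> \<le> ennreal B * weak_Ainf w"
        unfolding weak_Ainf_def using l pos
        by (intro mult_left_mono SUP_upper2[of "(c, l)"]) auto
      finally show "(\<integral>\<^sup>+x\<in>cube c l. ennreal (\<bar>f x - avg f (cube c l)\<bar> * w x) \<partial>lebesgue) / ?W
        \<le> ennreal B * weak_Ainf w" .
    qed
  qed
  have "weak_Ainf w \<le> ennreal (A + B) * osc_sup w \<and> osc_sup w \<le> ennreal (A + B) * weak_Ainf w"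
    if w: "weight w" for w :: "real^'n \<Rightarrow> real"
  proof
    show "weak_Ainf w \<le> ennreal (A + B) * osc_sup w"
      using AB by (intro order_trans[OF upper[OF w]] mult_right_mono ennreal_leI) auto
    show "osc_sup w \<le> ennreal (A + B) * weak_Ainf w"
      using AB by (intro order_trans[OF lower[OF w]] mult_right_mono ennreal_leI) auto
  qed
  then show ?thesis
    using AB unfolding osc_sup_def by (intro exI[of _ "A + B"]) auto
qed

end
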